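(* Let $M$ be a countable structure in a countable language with the Lascar Property and such that $\mathrm{acl}^{\mathrm{g}}_M(\{a\})=\{a\}$ for every $a\in M$. Then $\mathrm{Aut}_{\mathrm{top}}(\mathrm{Aut}(M))\cong\mathrm{Aut}(\mathcal{E}_M)$. In particular, if $M$ has in addition the small index property, then $\mathrm{Aut}(\mathrm{Aut}(M))\cong\mathrm{Aut}(\mathcal{E}_M)$.
   Context: $G=\mathrm{Aut}(M)$ has the topology of pointwise convergence; $\mathrm{Aut}_{\mathrm{top}}(G)$ is the group of automorphisms of $G$ that are homeomorphisms. For $A\subseteq M$, $G_{(A)}$ and $G_{\{A\}}$ are the pointwise and setwise stabilizers; $\mathrm{acl}^{\mathrm{g}}_M(A)$ is the set of elements with finite $G_{(A)}$-orbit; $\mathbf{A}(M)=\{\mathrm{acl}^{\mathrm{g}}_M(A): A\subseteq M\text{ finite}\}$. $M$ has the Lascar Property if: (i) for all $K,S\in\mathbf{A}(M)$ with $S\not\subseteq K$ there are $g\in G_{(K)}$, $h\in G_{(S)}$ with $g^{-1}hg(S)\ne S$; (ii) for every open subgroup $H\le G$ there is $K\in\mathbf{A}(M)$ with $G_{(K)}\le H\le G_{\{K\}}$. The orbital structure $\mathcal{E}_M$ has domain $M$ and, for each $0<n<\omega$, a $2n$-ary relation $R_n$ interpreted as the orbit equivalence relation of the action of $G$ on $M^n$. $M$ has the small index property if every subgroup of $G$ of countable index is open. *)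

theory Defs
  imports "HOL-Analysis.Function_Topology" "HOL-Algebra.Coset" "HOL-Algebra.Bij"
begin

section \<open>First-order languages, structures and automorphisms\<close>

text \<open>Constants are function symbols of arity 0.\<close>

record ('f, 'r) language =
  fun_syms :: "'f set"
  fun_arity :: "'f \<Rightarrow> nat"
  rel_syms :: "'r set"
  rel_arity :: "'r \<Rightarrow> nat"

record ('f, 'r, 'a) fo_structure =
  universe :: "'a set"
  fun_interp :: "'f \<Rightarrow> 'a list \<Rightarrow> 'a"
  rel_interp :: "'r \<Rightarrow> 'a list set"

definition tuples :: "'a set \<Rightarrow> nat \<Rightarrow> 'a list set" where
  "tuples A n = {xs. length xs = n \<and> set xs \<subseteq> A}"

definition countable_language :: "('f, 'r) language \<Rightarrow> bool" where
  "countable_language L \<longleftrightarrow> countable (fun_syms L) \<and> countable (rel_syms L)"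

definition is_structure :: "('f, 'r) language \<Rightarrow> ('f, 'r, 'a) fo_structure \<Rightarrow> bool" where
  "is_structure L M \<longleftrightarrow>
     universe M \<noteq> {} \<and>
     (\<forall>f\<in>fun_syms L. \<forall>xs\<in>tuples (universe M) (fun_arity L f). fun_interp M f xs \<in> universe M) \<and>
     (\<forall>r\<in>rel_syms L. rel_interp M r \<subseteq> tuples (universe M) (rel_arity L r))"

text \<open>As in \<^theory>\<open>HOL-Algebra.Bij\<close>, permutations of the domain are
  extensional functions, so that they are determined by their values on the domain.\<close>

definition automorphisms ::
    "('f, 'r) language \<Rightarrow> ('f, 'r, 'a) fo_structure \<Rightarrow> ('a \<Rightarrow> 'a) set" where
  "automorphisms L M = {g \<in> Bij (universe M).
     (\<forall>f\<in>fun_syms L. \<forall>xs\<in>tuples (universe M) (fun_arity L f).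
        g (fun_interp M f xs) = fun_interp M f (map g xs)) \<and>
     (\<forall>r\<in>rel_syms L. \<forall>xs\<in>tuples (universe M) (rel_arity L r).
        xs \<in> rel_interp M r \<longleftrightarrow> map g xs \<in> rel_interp M r)}"

definition Aut ::
    "('f, 'r) language \<Rightarrow> ('f, 'r, 'a) fo_structure \<Rightarrow> ('a \<Rightarrow> 'a) monoid" where
  "Aut L M = (BijGroup (universe M)) \<lparr>carrier := automorphisms L M\<rparr>"

section \<open>The topology of pointwise convergence\<close>

definition Aut_topology ::
    "('f, 'r) language \<Rightarrow> ('f, 'r, 'a) fo_structure \<Rightarrow> ('a \<Rightarrow> 'a) topology" where
  "Aut_topology L M =
     subtopology (product_topology (\<lambda>_. discrete_topology (universe M)) (universe M)) (carrier (Aut L M))"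

definition Aut_top :: "('g, 'm) monoid_scheme \<Rightarrow> 'g topology \<Rightarrow> ('g \<Rightarrow> 'g) monoid" where
  "Aut_top G T = (AutoGroup G) \<lparr>carrier := {\<phi> \<in> carrier (AutoGroup G). homeomorphic_map T T \<phi>}\<rparr>"

definition small_index_property ::
    "('f, 'r) language \<Rightarrow> ('f, 'r, 'a) fo_structure \<Rightarrow> bool" where
  "small_index_property L M \<longleftrightarrow>
     (\<forall>H. subgroup H (Aut L M) \<and> countable (rcosets\<^bsub>Aut L M\<^esub> H) \<longrightarrow> openin (Aut_topology L M) H)"

section \<open>Stabilizers, group-theoretic algebraic closure and the Lascar Property\<close>

definition pw_stab ::
    "('f, 'r) language \<Rightarrow> ('f, 'r, 'a) fo_structure \<Rightarrow> 'a set \<Rightarrow> ('a \<Rightarrow> 'a) set" where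
  "pw_stab L M A = {g \<in> carrier (Aut L M). \<forall>a\<in>A. g a = a}"

definition set_stab ::
    "('f, 'r) language \<Rightarrow> ('f, 'r, 'a) fo_structure \<Rightarrow> 'a set \<Rightarrow> ('a \<Rightarrow> 'a) set" where
  "set_stab L M A = {g \<in> carrier (Aut L M). g ` A = A}"

definition aclg :: "('f, 'r) language \<Rightarrow> ('f, 'r, 'a) fo_structure \<Rightarrow> 'a set \<Rightarrow> 'a set" where
  "aclg L M A = {b \<in> universe M. finite ((\<lambda>g. g b) ` pw_stab L M A)}"

definition fg_closed_sets ::
    "('f, 'r) language \<Rightarrow> ('f, 'r, 'a) fo_structure \<Rightarrow> 'a set set" where
  "fg_closed_sets L M = {aclg L M A | A. finite A \<and> A \<subseteq> universe M}"

definition lascar_property ::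
    "('f, 'r) language \<Rightarrow> ('f, 'r, 'a) fo_structure \<Rightarrow> bool" where
  "lascar_property L M \<longleftrightarrow>
     (\<forall>K\<in>fg_closed_sets L M. \<forall>S\<in>fg_closed_sets L M. \<not> S \<subseteq> K \<longrightarrow>
        (\<exists>g\<in>pw_stab L M K. \<exists>h\<in>pw_stab L M S.
           (inv\<^bsub>Aut L M\<^esub> g \<otimes>\<^bsub>Aut L M\<^esub> h \<otimes>\<^bsub>Aut L M\<^esub> g) ` S \<noteq> S)) \<and>
     (\<forall>H. subgroup H (Aut L M) \<and> openin (Aut_topology L M) H \<longrightarrow>
        (\<exists>K\<in>fg_closed_sets L M. pw_stab L M K \<subseteq> H \<and> H \<subseteq> set_stab L M K))"

section \<open>The orbital structure\<close>

text \<open>The language has no function symbols (the type \<^typ>\<open>unit\<close> is a dummy); the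
  relation symbol \<open>R\<^sub>n\<close> is the natural number \<open>n > 0\<close>. A pair of \<open>n\<close>-tuples is coded
  as the concatenated \<open>2n\<close>-tuple.\<close>

definition orbital_language :: "(unit, nat) language" where
  "orbital_language =
     \<lparr>fun_syms = {}, fun_arity = (\<lambda>_. 0), rel_syms = {n. 0 < n}, rel_arity = (\<lambda>n. 2 * n)\<rparr>"

definition orbital_structure ::
    "('f, 'r) language \<Rightarrow> ('f, 'r, 'a) fo_structure \<Rightarrow> (unit, nat, 'a) fo_structure" where
  "orbital_structure L M =
     \<lparr>universe = universe M,
      fun_interp = (\<lambda>_ _. undefined),
      rel_interp = (\<lambda>n. {xs @ ys | xs ys. xs \<in> tuples (universe M) n \<and> ys \<in> tuples (universe M) n \<and>
                                         (\<exists>g\<in>carrier (Aut L M). ys = map g xs)})\<rparr>"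

section \<open>Basic facts\<close>

lemma map_Bij_tuples: "g \<in> Bij A \<Longrightarrow> xs \<in> tuples A n \<Longrightarrow> map g xs \<in> tuples A n"
  using Bij_imp_funcset[of g A] by (auto simp: tuples_def)

lemma subgroup_automorphisms:
  assumes M: "is_structure L M"
  shows "subgroup (automorphisms L M) (BijGroup (universe M))"
proof (rule group.subgroupI[OF group_BijGroup])
  show "automorphisms L M \<subseteq> carrier (BijGroup (universe M))"
    by (auto simp: automorphisms_def BijGroup_def)
  have id_map: "map (\<lambda>x\<in>universe M. x) xs = xs" if "xs \<in> tuples (universe M) n" for xs n
    using that by (auto simp: tuples_def intro!: map_idI)
  have "(\<lambda>x\<in>universe M. x) \<in> automorphisms L M"
    using M by (auto simp: automorphisms_def id_Bij id_map is_structure_def)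
  then show "automorphisms L M \<noteq> {}" by blast
next
  fix g assume g: "g \<in> automorphisms L M"
  let ?A = "universe M" and ?h = "\<lambda>x\<in>universe M. inv_into (universe M) g x"
  have gB: "g \<in> Bij ?A" using g by (simp add: automorphisms_def)
  have hB: "?h \<in> Bij ?A" using restrict_inv_into_Bij[OF gB] by simp
  have hg: "?h (g x) = x" if "x \<in> ?A" for x
    using gB that by (auto simp: Bij_def bij_betw_def inv_into_f_f)
  have gh: "g (?h x) = x" if "x \<in> ?A" for x
    using gB that by (auto simp: Bij_def bij_betw_def f_inv_into_f)
  have mgh: "map g (map ?h xs) = xs" if "xs \<in> tuples ?A n" for xs n
  proof -
    have "map (\<lambda>x. g (?h x)) xs = xs"
      using that gh by (intro map_idI) (auto simp: tuples_def)
    then show ?thesis by (simp add: comp_def)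
  qed
  have "?h \<in> automorphisms L M"
    unfolding automorphisms_def mem_Collect_eq
  proof (intro conjI ballI)
    show "?h \<in> Bij ?A" by (rule hB)
  next
    fix f xs assume f: "f \<in> fun_syms L" and xs: "xs \<in> tuples ?A (fun_arity L f)"
    have hxs: "map ?h xs \<in> tuples ?A (fun_arity L f)" by (rule map_Bij_tuples[OF hB xs])
    then have "g (fun_interp M f (map ?h xs)) = fun_interp M f (map g (map ?h xs))"
      using g f unfolding automorphisms_def by blast
    also have "\<dots> = fun_interp M f xs" by (simp only: mgh[OF xs])
    finally have eq: "fun_interp M f xs = g (fun_interp M f (map ?h xs))" by (rule sym)
    have "fun_interp M f (map ?h xs) \<in> ?A" using M f hxs unfolding is_structure_def by blast
    then show "?h (fun_interp M f xs) = fun_interp M f (map ?h xs)"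
      unfolding eq by (rule hg)
  next
    fix r xs assume r: "r \<in> rel_syms L" and xs: "xs \<in> tuples ?A (rel_arity L r)"
    have "map ?h xs \<in> rel_interp M r \<longleftrightarrow> map g (map ?h xs) \<in> rel_interp M r"
      using g r map_Bij_tuples[OF hB xs] unfolding automorphisms_def by blast
    then show "xs \<in> rel_interp M r \<longleftrightarrow> map ?h xs \<in> rel_interp M r"
      by (simp only: mgh[OF xs])
  qed
  then show "inv\<^bsub>BijGroup ?A\<^esub> g \<in> automorphisms L M"
    using gB by (simp add: inv_BijGroup)
next
  fix g h assume g: "g \<in> automorphisms L M" and h: "h \<in> automorphisms L M"
  let ?A = "universe M"
  have gB: "g \<in> Bij ?A" and hB: "h \<in> Bij ?A" using g h by (simp_all add: automorphisms_def)
  have mc: "map (compose ?A g h) xs = map g (map h xs)" if "xs \<in> tuples ?A n" for xs n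
    using that by (auto simp: tuples_def compose_def)
  have "compose ?A g h \<in> automorphisms L M"
    unfolding automorphisms_def mem_Collect_eq
  proof (intro conjI ballI)
    show "compose ?A g h \<in> Bij ?A" by (rule compose_Bij[OF gB hB])
  next
    fix f xs assume f: "f \<in> fun_syms L" and xs: "xs \<in> tuples ?A (fun_arity L f)"
    have "fun_interp M f xs \<in> ?A" using M f xs unfolding is_structure_def by blast
    then have "compose ?A g h (fun_interp M f xs) = g (h (fun_interp M f xs))"
      by (simp add: compose_def)
    also have "h (fun_interp M f xs) = fun_interp M f (map h xs)"
      using h f xs unfolding automorphisms_def by blast
    also have "g \<dots> = fun_interp M f (map g (map h xs))"
      using g f map_Bij_tuples[OF hB xs] unfolding automorphisms_def by blast
    finally show "compose ?A g h (fun_interp M f xs) = fun_interp M f (map (compose ?A g h) xs)"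
      by (simp only: mc[OF xs])
  next
    fix r xs assume r: "r \<in> rel_syms L" and xs: "xs \<in> tuples ?A (rel_arity L r)"
    have "xs \<in> rel_interp M r \<longleftrightarrow> map h xs \<in> rel_interp M r"
      using h r xs unfolding automorphisms_def by blast
    also have "\<dots> \<longleftrightarrow> map g (map h xs) \<in> rel_interp M r"
      using g r map_Bij_tuples[OF hB xs] unfolding automorphisms_def by blast
    finally show "xs \<in> rel_interp M r \<longleftrightarrow> map (compose ?A g h) xs \<in> rel_interp M r"
      by (simp only: mc[OF xs])
  qed
  then show "g \<otimes>\<^bsub>BijGroup ?A\<^esub> h \<in> automorphisms L M"
    using gB hB by (simp add: BijGroup_def)
qed

lemma group_Aut: "is_structure L M \<Longrightarrow> group (Aut L M)"
  unfolding Aut_def by (rule subgroup.subgroup_is_group[OF subgroup_automorphisms group_BijGroup])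

lemma is_structure_orbital_structure:
  "is_structure L M \<Longrightarrow> is_structure orbital_language (orbital_structure L M)"
  by (fastforce simp: is_structure_def orbital_language_def orbital_structure_def tuples_def
      image_subset_iff subset_iff)

end

theory Submission
  imports Defs "HOL-Analysis.Finite_Cartesian_Product"
begin

text \<open>
  \<open>Aut(\<E>\<^sub>M)\<close> is the normalizer of \<open>G = Aut(M)\<close> in the symmetric group of \<open>M\<close>, since \<open>G\<close> is closed
  there; it acts on \<open>G\<close> by conjugation. The action is faithful because \<open>acl(a) = {a}\<close> makes the
  point stabilizers \<open>G\<^sub>a\<close> pairwise distinct. It exhausts the topological automorphisms as soon as
  every such \<open>\<phi>\<close> permutes the point stabilizers.

  By the Lascar Property an open subgroup \<open>H\<close> determines a set \<open>K(H)\<close> with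
  \<open>G\<^bsub>(K)\<^esub> \<le> H \<le> G\<^bsub>{K}\<^esub>\<close>, and \<open>G\<^sub>a\<close> is maximal among the proper open subgroups. Put
  \<open>K = K(\<phi>(G\<^sub>a))\<close>, so \<open>\<phi>(G\<^sub>a) = G\<^bsub>{K}\<^esub>\<close> by maximality, and choose \<open>b \<in> K\<close> and a finite \<open>A \<ni> b\<close> with
  \<open>acl(A) = K\<close>. The set \<open>K\<close> may be infinite and \<open>G\<^bsub>(K)\<^esub>\<close> not open, but \<open>G\<^bsub>{K}\<^esub>\<close> commensurates
  \<open>G\<^bsub>(A)\<^esub>\<close>, hence \<open>G\<^sub>a\<close> commensurates \<open>V = \<phi>\<^sup>-\<^sup>1(G\<^bsub>(A)\<^esub>)\<close>. Passing to a finite index subgroup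
  does not change \<open>K(V)\<close>, so \<open>K(V)\<close> is \<open>G\<^sub>a\<close>-invariant, which forces \<open>K(V) = {a}\<close> and \<open>V = G\<^sub>a\<close>.
  Therefore \<open>\<phi>(G\<^sub>a) \<le> G\<^sub>b\<close>, with equality by maximality.
\<close>

section \<open>Images of factoring maps, and extensional permutations\<close>

lemma countable_image_if_factors:
  assumes "countable (r ` S)" and "\<And>x y. x \<in> S \<Longrightarrow> y \<in> S \<Longrightarrow> r x = r y \<Longrightarrow> c x = c y"
  shows "countable (c ` S)"
proof -
  \<comment> \<open>Every value of \<open>c\<close> is attained at a chosen
    \<open>r\<close>-preimage, so \<open>c\<close> factors through \<open>r\<close> on
    \<open>S\<close>.\<close>
  have "c x = c (inv_into S r (r x))" if "x \<in> S" for x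
    using that by (intro assms(2)) (auto simp: inv_into_into f_inv_into_f)
  then have "c ` S = (\<lambda>v. c (inv_into S r v)) ` r ` S"
    by (auto simp: image_image)
  then show ?thesis using assms(1) by simp
qed

lemma carrier_BijGroup: "carrier (BijGroup X) = Bij X"
  by (simp add: BijGroup_def)

lemma BijGroup_apply:
  "\<lbrakk>f \<in> Bij X; g \<in> Bij X; x \<in> X\<rbrakk> \<Longrightarrow> (f \<otimes>\<^bsub>BijGroup X\<^esub> g) x = f (g x)"
  by (simp add: BijGroup_def compose_eq)

lemma BijGroup_inv_apply:
  assumes "f \<in> Bij X" "x \<in> X"
  shows "(inv\<^bsub>BijGroup X\<^esub> f) x \<in> X" "(inv\<^bsub>BijGroup X\<^esub> f) (f x) = x" "f ((inv\<^bsub>BijGroup X\<^esub> f) x) = x"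
  using assms by (auto simp: inv_BijGroup Bij_inv_into_mem Bij_def bij_betw_def inv_into_f_f f_inv_into_f)

lemma Bij_ext: "\<lbrakk>f \<in> Bij X; g \<in> Bij X; \<And>x. x \<in> X \<Longrightarrow> f x = g x\<rbrakk> \<Longrightarrow> f = g"
  by (meson Bij_imp_extensional extensionalityI)

section \<open>The automorphism group as a closed permutation group\<close>

locale aut_structure =
  fixes L :: "('f, 'r) language" and M :: "('f, 'r, 'a) fo_structure"
  assumes struct: "is_structure L M"
begin

abbreviation "G \<equiv> Aut L M"
abbreviation "X \<equiv> universe M"
abbreviation "T \<equiv> Aut_topology L M"

sublocale group "Aut L M"
  by (rule group_Aut[OF struct])

lemma carrier_Bij: "g \<in> carrier G \<Longrightarrow> g \<in> Bij X"
  by (simp add: Aut_def automorphisms_def)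

lemma carrier_extensional: "g \<in> carrier G \<Longrightarrow> g \<in> extensional X"
  by (simp add: Bij_imp_extensional carrier_Bij)

lemma mult_BijGroup: "g \<otimes>\<^bsub>G\<^esub> h = g \<otimes>\<^bsub>BijGroup X\<^esub> h"
  by (simp add: Aut_def)

lemma inv_BijGroup_eq: "g \<in> carrier G \<Longrightarrow> inv\<^bsub>G\<^esub> g = inv\<^bsub>BijGroup X\<^esub> g"
  unfolding Aut_def
  using group.m_inv_consistent[OF group_BijGroup subgroup_automorphisms[OF struct]] by simp

lemma mult_apply [simp]:
  "\<lbrakk>g \<in> carrier G; h \<in> carrier G; x \<in> X\<rbrakk> \<Longrightarrow> (g \<otimes>\<^bsub>G\<^esub> h) x = g (h x)"
  by (simp add: mult_BijGroup BijGroup_apply carrier_Bij)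

lemma one_apply [simp]: "x \<in> X \<Longrightarrow> \<one>\<^bsub>G\<^esub> x = x"
  by (simp add: Aut_def BijGroup_def)

lemma apply_closed [simp]: "\<lbrakk>g \<in> carrier G; x \<in> X\<rbrakk> \<Longrightarrow> g x \<in> X"
  using Bij_imp_funcset carrier_Bij by blast

lemma inv_apply [simp]:
  assumes "g \<in> carrier G" "x \<in> X"
  shows "(inv\<^bsub>G\<^esub> g) (g x) = x" "g ((inv\<^bsub>G\<^esub> g) x) = x"
  using assms by (simp_all add: inv_BijGroup_eq BijGroup_inv_apply carrier_Bij)

lemma inv_apply_iff:
  "\<lbrakk>g \<in> carrier G; x \<in> X; y \<in> X\<rbrakk> \<Longrightarrow> (inv\<^bsub>G\<^esub> g) x = y \<longleftrightarrow> x = g y"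
  using inv_apply by metis

lemma apply_eq_iff: "\<lbrakk>g \<in> carrier G; x \<in> X; y \<in> X\<rbrakk> \<Longrightarrow> g x = g y \<longleftrightarrow> x = y"
  using inv_apply by metis

lemma carrier_ext:
  "\<lbrakk>g \<in> carrier G; h \<in> carrier G; \<And>x. x \<in> X \<Longrightarrow> g x = h x\<rbrakk> \<Longrightarrow> g = h"
  by (meson Bij_ext carrier_Bij)

text \<open>Being an automorphism is tested on finitely many points at a time: the entries of one
  tuple and, for a function symbol, also its value there. This is the closedness of \<open>G\<close>
  in the symmetric group.\<close>

lemma carrier_if_locally_carrier:
  assumes f: "f \<in> Bij X"
    and loc: "\<And>A. finite A \<Longrightarrow> A \<subseteq> X \<Longrightarrow> \<exists>g\<in>carrier G. \<forall>a\<in>A. g a = f a"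
  shows "f \<in> carrier G"
proof -
  have "f (fun_interp M s xs) = fun_interp M s (map f xs)"
    if s: "s \<in> fun_syms L" and xs: "xs \<in> tuples X (fun_arity L s)" for s xs
  proof -
    have "fun_interp M s xs \<in> X" using struct s xs unfolding is_structure_def by blast
    moreover have "set xs \<subseteq> X" using xs by (simp add: tuples_def)
    ultimately obtain g where g: "g \<in> carrier G"
      and eq: "\<forall>a\<in>insert (fun_interp M s xs) (set xs). g a = f a"
      using loc[of "insert (fun_interp M s xs) (set xs)"] by auto
    have "map g xs = map f xs" using eq by auto
    moreover have "g (fun_interp M s xs) = fun_interp M s (map g xs)"
      using g s xs unfolding Aut_def automorphisms_def by auto
    moreover have "g (fun_interp M s xs) = f (fun_interp M s xs)" using eq by blast
    ultimately show ?thesis by metis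
  qed
  moreover have "xs \<in> rel_interp M r \<longleftrightarrow> map f xs \<in> rel_interp M r"
    if r: "r \<in> rel_syms L" and xs: "xs \<in> tuples X (rel_arity L r)" for r xs
  proof -
    have "set xs \<subseteq> X" using xs by (simp add: tuples_def)
    then obtain g where g: "g \<in> carrier G" and eq: "\<forall>a\<in>set xs. g a = f a"
      using loc[of "set xs"] by auto
    have "map g xs = map f xs" using eq by auto
    moreover have "xs \<in> rel_interp M r \<longleftrightarrow> map g xs \<in> rel_interp M r"
      using g r xs unfolding Aut_def automorphisms_def by auto
    ultimately show ?thesis by metis
  qed
  ultimately show ?thesis using f by (simp add: Aut_def automorphisms_def)
qed

section \<open>The topology of pointwise convergence\<close>

lemma topspace_T [simp]: "topspace T = carrier G"
proof -
  have "carrier G \<subseteq> (\<Pi>\<^sub>E i\<in>X. X)"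
    using carrier_extensional by (simp add: PiE_iff subset_iff)
  then show ?thesis by (auto simp: Aut_topology_def)
qed

text \<open>A basic open set of the product restricts only finitely many coordinates, and
  discreteness allows each of these to be restricted to a single value.\<close>

lemma openin_T_iff:
  "openin T U \<longleftrightarrow> U \<subseteq> carrier G \<and>
     (\<forall>g\<in>U. \<exists>A. finite A \<and> A \<subseteq> X \<and> (\<forall>h\<in>carrier G. (\<forall>a\<in>A. h a = g a) \<longrightarrow> h \<in> U))"
  (is "_ \<longleftrightarrow> ?R")
proof
  assume "openin T U"
  then obtain V where V: "openin (product_topology (\<lambda>_. discrete_topology X) X) V"
    and U: "U = V \<inter> carrier G"
    unfolding Aut_topology_def openin_subtopology by blast
  have "\<exists>A. finite A \<and> A \<subseteq> X \<and> (\<forall>h\<in>carrier G. (\<forall>a\<in>A. h a = g a) \<longrightarrow> h \<in> U)" if g: "g \<in> U" for g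
  proof -
    obtain W where fin: "finite {i\<in>X. W i \<noteq> X}" and gW: "g \<in> Pi\<^sub>E X W" and sub: "Pi\<^sub>E X W \<subseteq> V"
      using V g unfolding U openin_product_topology_alt by auto
    have "h \<in> U" if h: "h \<in> carrier G" and eq: "\<forall>a\<in>{i\<in>X. W i \<noteq> X}. h a = g a" for h
    proof -
      have "h i \<in> W i" if "i \<in> X" for i
      proof (cases "W i = X")
        case True
        then show ?thesis using h that by simp
      next
        case False
        then show ?thesis using eq gW that by (auto simp: PiE_iff)
      qed
      then have "h \<in> Pi\<^sub>E X W"
        using h carrier_extensional by (simp add: PiE_iff)
      then show ?thesis using sub h U by blast
    qed
    with fin show ?thesis by (intro exI[of _ "{i\<in>X. W i \<noteq> X}"]) auto
  qed
  then show ?R using U by blast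
next
  assume R: ?R
  show "openin T U"
  proof (subst openin_subopen, intro ballI)
    fix g assume g: "g \<in> U"
    then obtain A where A: "finite A" "A \<subseteq> X"
      and sub: "\<forall>h\<in>carrier G. (\<forall>a\<in>A. h a = g a) \<longrightarrow> h \<in> U"
      using R by blast
    have gc: "g \<in> carrier G" using R g by blast
    let ?W = "\<lambda>i. if i \<in> A then {g i} else X"
    have "finite {i\<in>X. ?W i \<noteq> X}"
      by (rule finite_subset[OF _ A(1)]) auto
    then have "openin (product_topology (\<lambda>_. discrete_topology X) X) (Pi\<^sub>E X ?W)"
      using gc A by (subst openin_PiE_gen) (auto simp: subset_iff)
    then have "openin T (Pi\<^sub>E X ?W \<inter> carrier G)"
      unfolding Aut_topology_def openin_subtopology by blast
    moreover have "g \<in> Pi\<^sub>E X ?W"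
      using gc carrier_extensional by (simp add: PiE_iff)
    moreover have "Pi\<^sub>E X ?W \<inter> carrier G \<subseteq> U"
    proof
      fix h assume h: "h \<in> Pi\<^sub>E X ?W \<inter> carrier G"
      have "h a = g a" if "a \<in> A" for a
        using PiE_mem[of h X ?W a] h that A(2) by auto
      then show "h \<in> U" using sub h by blast
    qed
    ultimately show "\<exists>V. openin T V \<and> g \<in> V \<and> V \<subseteq> U" using gc by blast
  qed
qed

text \<open>If \<open>h\<close> agrees on \<open>A\<close> with \<open>g\<close> in
  \<open>H\<close>, then \<open>g^-1 h\<close> fixes \<open>A\<close> pointwise and so lies in
  \<open>H\<close>. Thus a neighbourhood of the identity inside \<open>H\<close> translates to every
  point of \<open>H\<close>.\<close>

lemma openin_subgroup_iff:
  assumes H: "subgroup H G"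
  shows "openin T H \<longleftrightarrow> (\<exists>A. finite A \<and> A \<subseteq> X \<and> pw_stab L M A \<subseteq> H)"
proof
  assume "openin T H"
  then obtain A where "finite A" "A \<subseteq> X" "\<forall>h\<in>carrier G. (\<forall>a\<in>A. h a = \<one>\<^bsub>G\<^esub> a) \<longrightarrow> h \<in> H"
    unfolding openin_T_iff using subgroup.one_closed[OF H] by blast
  then show "\<exists>A. finite A \<and> A \<subseteq> X \<and> pw_stab L M A \<subseteq> H"
    by (intro exI[of _ A]) (auto simp: pw_stab_def subset_iff)
next
  assume "\<exists>A. finite A \<and> A \<subseteq> X \<and> pw_stab L M A \<subseteq> H"
  then obtain A where A: "finite A" "A \<subseteq> X" "pw_stab L M A \<subseteq> H" by blast
  show "openin T H" unfolding openin_T_iff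
  proof (intro conjI ballI exI impI)
    show "H \<subseteq> carrier G" by (rule subgroup.subset[OF H])
    fix g h assume g: "g \<in> H" and h: "h \<in> carrier G" and eq: "\<forall>a\<in>A. h a = g a"
    have gc: "g \<in> carrier G" using g subgroup.subset[OF H] by blast
    have "inv\<^bsub>G\<^esub> g \<otimes>\<^bsub>G\<^esub> h \<in> pw_stab L M A"
      using gc h eq A(2) by (auto simp: pw_stab_def subset_iff)
    then have "g \<otimes>\<^bsub>G\<^esub> (inv\<^bsub>G\<^esub> g \<otimes>\<^bsub>G\<^esub> h) \<in> H"
      using A(3) g subgroup.m_closed[OF H] by blast
    then show "h \<in> H" using gc h by (simp add: m_assoc[symmetric])
  qed (use A in auto)
qed

section \<open>Pointwise and setwise stabilizers\<close>

lemma subgroup_pw_stab: "A \<subseteq> X \<Longrightarrow> subgroup (pw_stab L M A) G"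
  by (rule subgroupI) (auto simp: pw_stab_def subset_iff inv_apply_iff intro!: exI[of _ "\<one>\<^bsub>G\<^esub>"])

text \<open>As \<open>K\<close> may be infinite, mapping \<open>K\<close> into itself does not make
  \<open>g\<close> map \<open>K\<close> onto itself; hence the condition on the inverse.\<close>

lemma set_stabI:
  assumes "g \<in> carrier G" "K \<subseteq> X" "\<And>x. x \<in> K \<Longrightarrow> g x \<in> K" "\<And>x. x \<in> K \<Longrightarrow> (inv\<^bsub>G\<^esub> g) x \<in> K"
  shows "g \<in> set_stab L M K"
proof -
  have "x \<in> g ` K" if "x \<in> K" for x
    using assms that by (intro image_eqI[of _ _ "(inv\<^bsub>G\<^esub> g) x"]) (auto simp: subset_iff)
  then show ?thesis using assms by (auto simp: set_stab_def)
qed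

lemma set_stab_inv:
  assumes "g \<in> set_stab L M K" "K \<subseteq> X" "x \<in> K" shows "(inv\<^bsub>G\<^esub> g) x \<in> K"
proof -
  obtain y where "y \<in> K" "x = g y" using assms unfolding set_stab_def by blast
  then show ?thesis using assms by (auto simp: set_stab_def)
qed

lemma set_stab_carrier: "g \<in> set_stab L M K \<Longrightarrow> g \<in> carrier G"
  by (simp add: set_stab_def)

lemma set_stab_apply: "g \<in> set_stab L M K \<Longrightarrow> x \<in> K \<Longrightarrow> g x \<in> K"
  by (auto simp: set_stab_def)

lemma subgroup_set_stab:
  assumes K: "K \<subseteq> X" shows "subgroup (set_stab L M K) G"
proof (rule subgroupI)
  have "\<one>\<^bsub>G\<^esub> \<in> set_stab L M K" using K by (intro set_stabI) (auto simp: subset_iff)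
  then show "set_stab L M K \<noteq> {}" by blast
next
  fix g assume g: "g \<in> set_stab L M K"
  then show "inv\<^bsub>G\<^esub> g \<in> set_stab L M K"
    using K set_stab_inv[OF g K] by (intro set_stabI) (auto simp: set_stab_def)
next
  fix g h assume gh: "g \<in> set_stab L M K" "h \<in> set_stab L M K"
  note c = gh[THEN set_stab_carrier]
  have "(g \<otimes>\<^bsub>G\<^esub> h) x \<in> K" "(inv\<^bsub>G\<^esub> (g \<otimes>\<^bsub>G\<^esub> h)) x \<in> K" if "x \<in> K" for x
    using that gh c K set_stab_inv[OF gh(1) K] set_stab_inv[OF gh(2) K]
    by (auto simp: set_stab_apply subset_iff inv_mult_group)
  then show "g \<otimes>\<^bsub>G\<^esub> h \<in> set_stab L M K"
    using K c by (intro set_stabI) auto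
qed (auto simp: set_stab_def)

lemma set_stab_singleton: "a \<in> X \<Longrightarrow> set_stab L M {a} = pw_stab L M {a}"
  by (auto simp: set_stab_def pw_stab_def)

section \<open>Group-theoretic algebraic closure\<close>

lemma aclg_subset: "aclg L M A \<subseteq> X"
  by (auto simp: aclg_def)

lemma aclg_mono: "A \<subseteq> B \<Longrightarrow> aclg L M A \<subseteq> aclg L M B"
  unfolding aclg_def by (auto simp: pw_stab_def elim!: rev_finite_subset)

lemma subset_aclg: "A \<subseteq> X \<Longrightarrow> A \<subseteq> aclg L M A"
proof
  fix a assume "A \<subseteq> X" "a \<in> A"
  then have "(\<lambda>g. g a) ` pw_stab L M A \<subseteq> {a}" "a \<in> X" by (auto simp: pw_stab_def)
  then show "a \<in> aclg L M A" using finite_subset[of _ "{a}"] by (simp add: aclg_def)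
qed

lemma pw_stab_image_conj:
  assumes "g \<in> carrier G" "A \<subseteq> X" "h \<in> pw_stab L M (g ` A)"
  shows "inv\<^bsub>G\<^esub> g \<otimes>\<^bsub>G\<^esub> (h \<otimes>\<^bsub>G\<^esub> g) \<in> pw_stab L M A"
  using assms by (auto simp: pw_stab_def subset_iff)

text \<open>If \<open>h\<close> fixes \<open>g(A)\<close> pointwise, then
  \<open>h(g(b)) = g(h'(b))\<close> for the conjugate \<open>h' = g^-1 h g\<close>, which fixes
  \<open>A\<close> pointwise. So the orbit of \<open>g(b)\<close> lies in the image under
  \<open>g\<close> of the finite orbit of \<open>b\<close>.\<close>

lemma image_aclg_subset:
  assumes g: "g \<in> carrier G" and A: "A \<subseteq> X"
  shows "g ` aclg L M A \<subseteq> aclg L M (g ` A)"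
proof
  fix c assume "c \<in> g ` aclg L M A"
  then obtain b where b: "b \<in> X" "finite ((\<lambda>g. g b) ` pw_stab L M A)" and c: "c = g b"
    by (auto simp: aclg_def)
  have "h c \<in> g ` (\<lambda>g. g b) ` pw_stab L M A" if h: "h \<in> pw_stab L M (g ` A)" for h
  proof -
    have hc: "h \<in> carrier G" using h by (simp add: pw_stab_def)
    have "h c = g ((inv\<^bsub>G\<^esub> g \<otimes>\<^bsub>G\<^esub> (h \<otimes>\<^bsub>G\<^esub> g)) b)" using b c g hc by simp
    then show ?thesis using pw_stab_image_conj[OF g A h] by blast
  qed
  then have "(\<lambda>h. h c) ` pw_stab L M (g ` A) \<subseteq> g ` (\<lambda>g. g b) ` pw_stab L M A" by blast
  then have "finite ((\<lambda>h. h c) ` pw_stab L M (g ` A))"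
    using b(2) finite_subset by blast
  then show "c \<in> aclg L M (g ` A)" using b c g by (simp add: aclg_def)
qed

lemma inv_image_image:
  assumes "g \<in> carrier G" "A \<subseteq> X"
  shows "(inv\<^bsub>G\<^esub> g) ` g ` A = A" "g ` (inv\<^bsub>G\<^esub> g) ` A = A"
  using assms by (auto simp: image_image subset_iff image_iff)

lemma image_aclg:
  assumes g: "g \<in> carrier G" and A: "A \<subseteq> X"
  shows "g ` aclg L M A = aclg L M (g ` A)"
proof
  have "(inv\<^bsub>G\<^esub> g) ` aclg L M (g ` A) \<subseteq> aclg L M A"
    using image_aclg_subset[of "inv\<^bsub>G\<^esub> g" "g ` A"] g A inv_image_image(1)[OF g A]
    by (metis apply_closed image_subsetI inv_closed subsetD)
  then show "aclg L M (g ` A) \<subseteq> g ` aclg L M A"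
    using inv_image_image(2)[OF g aclg_subset] by (metis image_mono)
qed (rule image_aclg_subset[OF g A])

lemma image_fg_closed_sets:
  assumes "g \<in> carrier G" "K \<in> fg_closed_sets L M" shows "g ` K \<in> fg_closed_sets L M"
proof -
  obtain A where "finite A" "A \<subseteq> X" "K = aclg L M A"
    using assms(2) by (auto simp: fg_closed_sets_def)
  then show ?thesis using assms(1) image_aclg[of g A]
    unfolding fg_closed_sets_def by (auto intro!: exI[of _ "g ` A"])
qed

lemma fg_closed_sets_subset: "K \<in> fg_closed_sets L M \<Longrightarrow> K \<subseteq> X"
  by (auto simp: fg_closed_sets_def aclg_def)

text \<open>Closure commutes with automorphisms, so an element fixing \<open>A\<close> preserves
  \<open>acl(A)\<close>. For finite \<open>A\<close> this makes the setwise stabilizer of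
  \<open>acl(A)\<close> open, even where the pointwise one is not.\<close>

lemma pw_stab_subset_set_stab_aclg:
  assumes "A \<subseteq> X" shows "pw_stab L M A \<subseteq> set_stab L M (aclg L M A)"
proof
  fix g assume g: "g \<in> pw_stab L M A"
  then have "g ` A = A" by (auto simp: pw_stab_def image_iff)
  with g show "g \<in> set_stab L M (aclg L M A)"
    using image_aclg[of g A] assms by (auto simp: set_stab_def pw_stab_def)
qed

text \<open>Each point of \<open>B\<close> has a finite orbit under \<open>G_(A)\<close>, so the
  elements of \<open>G_(A)\<close> have only finitely many restrictions to the finite set
  \<open>B\<close>, and \<open>F\<close> holds one representative of each. In other words,
  \<open>G_(A \<union> B)\<close> has finite index in \<open>G_(A)\<close>.\<close>

lemma pw_stab_cosets_finite:
  assumes A: "A \<subseteq> X" and B: "finite B" "B \<subseteq> aclg L M A"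
  shows "\<exists>F. finite F \<and> F \<subseteq> pw_stab L M A \<and> (\<forall>x\<in>pw_stab L M A. \<exists>f\<in>F. \<forall>b\<in>B. f b = x b)"
proof -
  let ?S = "pw_stab L M A" and ?r = "\<lambda>x. restrict x B"
  have "?r ` ?S \<subseteq> (\<Pi>\<^sub>E b\<in>B. (\<lambda>g. g b) ` ?S)" by auto
  moreover have "finite (\<Pi>\<^sub>E b\<in>B. (\<lambda>g. g b) ` ?S)"
    using B by (intro finite_PiE) (auto simp: aclg_def)
  ultimately have fin: "finite (?r ` ?S)" by (rule finite_subset)
  let ?F = "inv_into ?S ?r ` ?r ` ?S"
  have "\<exists>f\<in>?F. \<forall>b\<in>B. f b = x b" if "x \<in> ?S" for x
  proof (intro bexI ballI)
    fix b assume "b \<in> B"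
    have "?r (inv_into ?S ?r (?r x)) = ?r x"
      by (rule f_inv_into_f[of "?r x" ?r]) (use that in blast)
    then show "inv_into ?S ?r (?r x) b = x b" using \<open>b \<in> B\<close> by (metis restrict_apply')
  qed (use that in blast)
  moreover have "?F \<subseteq> ?S" by (auto intro: inv_into_into)
  ultimately show ?thesis using fin by blast
qed

text \<open>The setwise stabilizer of \<open>K = acl(A)\<close> commensurates \<open>G\<^sub>(\<^sub>A\<^sub>)\<close>: both \<open>A\<close> and \<open>k(A)\<close> lie
  in \<open>K\<close>, so only finitely many cosets are needed to fix them.\<close>

lemma pw_stab_commensurated:
  assumes A: "finite A" "A \<subseteq> K" "K \<subseteq> aclg L M A" and k: "k \<in> set_stab L M K"
  shows "\<exists>F. finite F \<and> F \<subseteq> carrier G \<and> (\<forall>x\<in>pw_stab L M A. \<exists>f\<in>F.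
    x \<otimes>\<^bsub>G\<^esub> f \<in> pw_stab L M A \<and> inv\<^bsub>G\<^esub> k \<otimes>\<^bsub>G\<^esub> (x \<otimes>\<^bsub>G\<^esub> f \<otimes>\<^bsub>G\<^esub> k) \<in> pw_stab L M A)"
proof -
  have AX: "A \<subseteq> X" using A aclg_subset by blast
  have kc: "k \<in> carrier G" by (rule set_stab_carrier[OF k])
  have "k ` A \<subseteq> K" using k A by (auto simp: set_stab_def)
  then obtain F where F: "finite F" "F \<subseteq> pw_stab L M A"
    "\<forall>x\<in>pw_stab L M A. \<exists>f\<in>F. \<forall>b\<in>A \<union> k ` A. f b = x b"
    using pw_stab_cosets_finite[OF AX, of "A \<union> k ` A"] A by blast
  have FG: "F \<subseteq> carrier G" using F by (auto simp: pw_stab_def)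
  have "\<exists>f\<in>F. x \<otimes>\<^bsub>G\<^esub> f \<in> pw_stab L M A \<and> inv\<^bsub>G\<^esub> k \<otimes>\<^bsub>G\<^esub> (x \<otimes>\<^bsub>G\<^esub> f \<otimes>\<^bsub>G\<^esub> k) \<in> pw_stab L M A"
    if x: "x \<in> pw_stab L M A" for x
  proof -
    have xc: "x \<in> carrier G" using x by (simp add: pw_stab_def)
    \<comment> \<open>Matching \<open>f\<close> with the inverse of \<open>x\<close>, rather than
      with \<open>x\<close>, makes \<open>x f\<close> fix both \<open>A\<close> and
      \<open>k(A)\<close> pointwise.\<close>
    have "inv\<^bsub>G\<^esub> x \<in> pw_stab L M A" using subgroup.m_inv_closed[OF subgroup_pw_stab[OF AX] x] .
    then obtain f where f: "f \<in> F" "\<forall>b\<in>A \<union> k ` A. f b = (inv\<^bsub>G\<^esub> x) b" using F(3) by blast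
    have fc: "f \<in> carrier G" using f FG by blast
    have "x \<otimes>\<^bsub>G\<^esub> f \<in> pw_stab L M (A \<union> k ` A)"
      using xc fc f(2) AX kc by (auto simp: pw_stab_def subset_iff)
    then have "x \<otimes>\<^bsub>G\<^esub> f \<in> pw_stab L M A" "x \<otimes>\<^bsub>G\<^esub> f \<in> pw_stab L M (k ` A)"
      by (auto simp: pw_stab_def)
    then show ?thesis using pw_stab_image_conj[OF kc AX] f(1) by blast
  qed
  then show ?thesis using F FG by blast
qed

section \<open>Continuity of homomorphisms and the small index property\<close>

lemma subgroup_vimage:
  assumes "\<phi> \<in> hom G G" "subgroup H G"
  shows "subgroup {g \<in> carrier G. \<phi> g \<in> H} G"
proof -
  interpret \<phi>: group_hom G G \<phi>
    using assms by unfold_locales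
  show ?thesis
    using assms(2) by (intro subgroupI)
      (auto simp: subgroup.m_closed subgroup.m_inv_closed subgroup.one_closed intro!: exI[of _ "\<one>\<^bsub>G\<^esub>"])
qed

text \<open>The stabilizers \<open>G_(A)\<close> of finite sets form a neighbourhood base at the
  identity, and a homomorphism continuous there is continuous everywhere by translating with
  \<open>g^-1 h\<close>.\<close>

lemma continuous_map_if_open_vimage:
  assumes hom: "\<phi> \<in> hom G G"
    and op: "\<And>A. finite A \<Longrightarrow> A \<subseteq> X \<Longrightarrow> openin T {g \<in> carrier G. \<phi> g \<in> pw_stab L M A}"
  shows "continuous_map T T \<phi>"
proof -
  interpret \<phi>: group_hom G G \<phi>
    using hom by unfold_locales
  show ?thesis unfolding continuous_map_def
  proof (intro conjI allI impI)
    show "\<phi> \<in> topspace T \<rightarrow> topspace T" by auto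
    fix U assume U: "openin T U"
    show "openin T {x \<in> topspace T. \<phi> x \<in> U}" unfolding openin_T_iff
    proof (intro conjI ballI)
      fix g assume "g \<in> {x \<in> topspace T. \<phi> x \<in> U}"
      then have g: "g \<in> carrier G" "\<phi> g \<in> U" by auto
      then obtain A where A: "finite A" "A \<subseteq> X"
        "\<forall>h\<in>carrier G. (\<forall>a\<in>A. h a = \<phi> g a) \<longrightarrow> h \<in> U"
        using U unfolding openin_T_iff by blast
      obtain B where B: "finite B" "B \<subseteq> X"
        "pw_stab L M B \<subseteq> {g \<in> carrier G. \<phi> g \<in> pw_stab L M A}"
        using op[OF A(1,2)] openin_subgroup_iff[OF subgroup_vimage[OF hom subgroup_pw_stab[OF A(2)]]]
        by auto
      have "\<phi> h \<in> U" if h: "h \<in> carrier G" and eq: "\<forall>b\<in>B. h b = g b" for h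
      proof -
        have "inv\<^bsub>G\<^esub> g \<otimes>\<^bsub>G\<^esub> h \<in> pw_stab L M B"
          using h g eq B(2) by (auto simp: pw_stab_def subset_iff)
        then have "\<phi> (inv\<^bsub>G\<^esub> g \<otimes>\<^bsub>G\<^esub> h) \<in> pw_stab L M A" using B(3) by blast
        then have "inv\<^bsub>G\<^esub> (\<phi> g) \<otimes>\<^bsub>G\<^esub> \<phi> h \<in> pw_stab L M A" using g h by simp
        then have "\<phi> h a = \<phi> g a" if "a \<in> A" for a
          using that g h A(2) by (auto simp: pw_stab_def subset_iff inv_apply_iff)
        then show ?thesis using A(3) h by simp
      qed
      then show "\<exists>A. finite A \<and> A \<subseteq> X \<and>
          (\<forall>h\<in>carrier G. (\<forall>a\<in>A. h a = g a) \<longrightarrow> h \<in> {x \<in> topspace T. \<phi> x \<in> U})"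
        using B by (intro exI[of _ B]) auto
    qed auto
  qed
qed

text \<open>The preimage of \<open>G_(A)\<close> has countable index: its cosets are separated by
  restrictions of permutations to the finite set \<open>A\<close>, and a countable domain has only
  countably many of these.\<close>

lemma small_index_imp_continuous:
  assumes sip: "small_index_property L M" and cX: "countable X" and hom: "\<phi> \<in> hom G G"
  shows "continuous_map T T \<phi>"
proof (rule continuous_map_if_open_vimage[OF hom])
  interpret \<phi>: group_hom G G \<phi>
    using hom by unfold_locales
  fix A assume A: "finite A" "A \<subseteq> X"
  let ?H = "{g \<in> carrier G. \<phi> g \<in> pw_stab L M A}"
  have H: "subgroup ?H G" by (rule subgroup_vimage[OF hom subgroup_pw_stab[OF A(2)]])
  \<comment> \<open>The inverse appears because right cosets are counted: \<open>x\<close> and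
    \<open>y\<close> give the same one iff \<open>\<phi> x\<close> times the inverse of
    \<open>\<phi> y\<close> fixes \<open>A\<close> pointwise, that is, iff the inverses of the two
    images agree on \<open>A\<close>.\<close>
  let ?r = "\<lambda>x. restrict (inv\<^bsub>G\<^esub> (\<phi> x)) A"
  have "?r ` carrier G \<subseteq> (\<Pi>\<^sub>E a\<in>A. X)" using A by (auto simp: subset_iff)
  then have "countable (?r ` carrier G)"
    using countable_PiE[OF A(1), of "\<lambda>_. X"] cX countable_subset by blast
  moreover have "?H #>\<^bsub>G\<^esub> x = ?H #>\<^bsub>G\<^esub> y"
    if x: "x \<in> carrier G" and y: "y \<in> carrier G" and eq: "?r x = ?r y" for x y
  proof -
    have "(inv\<^bsub>G\<^esub> (\<phi> x)) a = (inv\<^bsub>G\<^esub> (\<phi> y)) a" if "a \<in> A" for a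
      using fun_cong[OF eq, of a] that by simp
    then have "\<phi> (x \<otimes>\<^bsub>G\<^esub> inv\<^bsub>G\<^esub> y) \<in> pw_stab L M A"
      using x y A by (auto simp: pw_stab_def subset_iff)
        (metis \<phi>.hom_closed inv_apply(2))
    then have "x \<otimes>\<^bsub>G\<^esub> inv\<^bsub>G\<^esub> y \<in> ?H" using x y by simp
    then have "?H #>\<^bsub>G\<^esub> (x \<otimes>\<^bsub>G\<^esub> inv\<^bsub>G\<^esub> y) = ?H"
      using H by (simp add: coset_join2 x y)
    then show ?thesis using coset_mult_inv1 x y by blast
  qed
  ultimately have "countable ((\<lambda>x. ?H #>\<^bsub>G\<^esub> x) ` carrier G)" by (rule countable_image_if_factors)
  moreover have "rcosets\<^bsub>G\<^esub> ?H = (\<lambda>x. ?H #>\<^bsub>G\<^esub> x) ` carrier G" by (auto simp: RCOSETS_def)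
  ultimately show "openin T ?H" using sip H by (auto simp: small_index_property_def)
qed

lemma conj_hom: "g \<in> carrier G \<Longrightarrow> (\<lambda>v. inv\<^bsub>G\<^esub> g \<otimes>\<^bsub>G\<^esub> (v \<otimes>\<^bsub>G\<^esub> g)) \<in> hom G G"
  by (rule homI) (auto intro!: carrier_ext)

section \<open>The orbital structure and the conjugation action on \<open>G\<close>\<close>

abbreviation "E \<equiv> Aut orbital_language (orbital_structure L M)"

lemma universe_orbital [simp]: "universe (orbital_structure L M) = X"
  by (simp add: orbital_structure_def)

lemma orbital_automorphism_iff:
  "f \<in> carrier E \<longleftrightarrow> f \<in> Bij X \<and>
     (\<forall>n>0. \<forall>xs\<in>tuples X n. \<forall>ys\<in>tuples X n.
        (\<exists>g\<in>carrier G. ys = map g xs) \<longleftrightarrow> (\<exists>g\<in>carrier G. map f ys = map g (map f xs)))"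
  (is "_ \<longleftrightarrow> _ \<and> ?R")
proof (cases "f \<in> Bij X")
  case True
  let ?rel = "rel_interp (orbital_structure L M)"
  have append_rel: "xs @ ys \<in> ?rel n \<longleftrightarrow> (\<exists>g\<in>carrier G. ys = map g xs)"
    if "xs \<in> tuples X n" "ys \<in> tuples X n" for n xs ys
    using that by (auto simp: orbital_structure_def tuples_def)
  have append_tuples: "xs @ ys \<in> tuples X (2 * n)" if "xs \<in> tuples X n" "ys \<in> tuples X n" for xs ys n
    using that by (auto simp: tuples_def)
  have split_tuples: "\<exists>xs\<in>tuples X n. \<exists>ys\<in>tuples X n. zs = xs @ ys" if "zs \<in> tuples X (2 * n)" for zs n
    using that set_take_subset[of n zs] set_drop_subset[of n zs]
    by (intro bexI[of _ "take n zs"] bexI[of _ "drop n zs"]) (auto simp: tuples_def)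
  have "f \<in> carrier E \<longleftrightarrow> (\<forall>n>0. \<forall>zs\<in>tuples X (2 * n). zs \<in> ?rel n \<longleftrightarrow> map f zs \<in> ?rel n)"
    using True by (simp add: Aut_def automorphisms_def orbital_language_def)
  also have "\<dots> \<longleftrightarrow> (\<forall>n>0. \<forall>xs\<in>tuples X n. \<forall>ys\<in>tuples X n. xs @ ys \<in> ?rel n \<longleftrightarrow> map f (xs @ ys) \<in> ?rel n)"
    using split_tuples append_tuples by metis
  also have "\<dots> \<longleftrightarrow> ?R"
    using append_rel map_Bij_tuples[OF True] by simp
  finally show ?thesis using True by simp
next
  case False
  then show ?thesis by (simp add: Aut_def automorphisms_def)
qed

text \<open>Makes the facts about \<open>G\<close> available for \<open>E\<close> as well, through
  the interpretation \<open>orb\<close>.\<close>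

lemma aut_structure_orbital: "aut_structure orbital_language (orbital_structure L M)"
  by unfold_locales (rule is_structure_orbital_structure[OF struct])

interpretation orb: aut_structure orbital_language "orbital_structure L M"
  by (rule aut_structure_orbital)

text \<open>The product is taken in the full symmetric group because \<open>f\<close> need not lie
  in \<open>G\<close>. The restriction to \<open>carrier G\<close> matches the extensional functions
  that form \<open>AutoGroup\<close>.\<close>

definition conj_by :: "('a \<Rightarrow> 'a) \<Rightarrow> ('a \<Rightarrow> 'a) \<Rightarrow> 'a \<Rightarrow> 'a" where
  "conj_by f = (\<lambda>g\<in>carrier G. f \<otimes>\<^bsub>BijGroup X\<^esub> g \<otimes>\<^bsub>BijGroup X\<^esub> inv\<^bsub>BijGroup X\<^esub> f)"

text \<open>\<open>G\<close> is closed in the symmetric group, so a permutation that on every tuple acts within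
  the \<open>G\<close>-orbit of that tuple belongs to \<open>G\<close>.\<close>

lemma conj_by_closed:
  assumes f: "f \<in> carrier E" and g: "g \<in> carrier G"
  shows "conj_by f g \<in> carrier G"
proof (rule carrier_if_locally_carrier)
  interpret B: group "BijGroup X" by (rule group_BijGroup)
  have fB: "f \<in> Bij X" and gB: "g \<in> Bij X" using f g orbital_automorphism_iff carrier_Bij by blast+
  then have c: "f \<in> carrier (BijGroup X)" "g \<in> carrier (BijGroup X)" by (simp_all add: carrier_BijGroup)
  then have "f \<otimes>\<^bsub>BijGroup X\<^esub> g \<otimes>\<^bsub>BijGroup X\<^esub> inv\<^bsub>BijGroup X\<^esub> f \<in> carrier (BijGroup X)" by simp
  then show "conj_by f g \<in> Bij X" using g by (simp only: conj_by_def restrict_apply' carrier_BijGroup)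
  let ?i = "inv\<^bsub>BijGroup X\<^esub> f"
  have iB: "?i \<in> Bij X" and fg: "f \<otimes>\<^bsub>BijGroup X\<^esub> g \<in> Bij X"
    using B.inv_closed[OF c(1)] B.m_closed[OF c] by (simp_all only: carrier_BijGroup)
  have app: "conj_by f g x = f (g (?i x))" if "x \<in> X" for x
    using that g fB gB iB fg by (simp add: conj_by_def BijGroup_apply BijGroup_inv_apply)
  fix A assume A: "finite A" "A \<subseteq> X"
  then obtain xs where xs: "set xs = A" using finite_list by blast
  show "\<exists>k\<in>carrier G. \<forall>a\<in>A. k a = conj_by f g a"
  \<comment> \<open>The relations \<open>R_n\<close> exist only for \<open>n > 0\<close>, so the
    empty tuple is treated apart; there any element of \<open>G\<close> serves.\<close>
  proof (cases "A = {}")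
    case True
    then show ?thesis using g by blast
  next
    case False
    then have n: "0 < length xs" using xs by auto
    have xsX: "xs \<in> tuples X (length xs)" using xs A by (simp add: tuples_def)
    \<comment> \<open>The tuples \<open>ys\<close> and \<open>g(ys)\<close> lie in one orbit, hence
      so do their images under \<open>f\<close>, which are \<open>xs\<close> and the conjugate
      applied to \<open>xs\<close>.\<close>
    let ?ys = "map ?i xs"
    have ys: "?ys \<in> tuples X (length xs)" by (rule map_Bij_tuples[OF iB xsX])
    have gys: "map g ?ys \<in> tuples X (length xs)" by (rule map_Bij_tuples[OF gB ys])
    have "\<exists>k\<in>carrier G. map f (map g ?ys) = map k (map f ?ys)"
      using f n ys gys g unfolding orbital_automorphism_iff by blast
    then obtain k where k: "k \<in> carrier G" "map f (map g ?ys) = map k (map f ?ys)" by blast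
    have "k a = conj_by f g a" if "a \<in> A" for a
    proof -
      have "f (g (?i a)) = k (f (?i a))" using k(2) that xs by (auto simp: map_eq_conv)
      then show ?thesis using app that A fB by (auto simp: BijGroup_inv_apply subset_iff)
    qed
    then show ?thesis using k by blast
  qed
qed

lemma orb_apply_closed: "f \<in> carrier E \<Longrightarrow> x \<in> X \<Longrightarrow> f x \<in> X"
  using orb.apply_closed[of f x] by simp

lemma orb_surj:
  assumes "f \<in> carrier E" "y \<in> X" obtains x where "x \<in> X" "y = f x"
proof
  show "(inv\<^bsub>E\<^esub> f) y \<in> X" "y = f ((inv\<^bsub>E\<^esub> f) y)"
    using assms orb.inv_apply(2)[of f y] orb.apply_closed[of "inv\<^bsub>E\<^esub> f" y] by simp_all
qed

lemma conj_by_apply: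
  assumes f: "f \<in> carrier E" and g: "g \<in> carrier G" and x: "x \<in> X"
  shows "conj_by f g (f x) = f (g x)"
proof -
  interpret B: group "BijGroup X" by (rule group_BijGroup)
  have fB: "f \<in> Bij X" and gB: "g \<in> Bij X" using f g orbital_automorphism_iff carrier_Bij by blast+
  then have c: "f \<in> carrier (BijGroup X)" "g \<in> carrier (BijGroup X)" by (simp_all add: carrier_BijGroup)
  have iB: "inv\<^bsub>BijGroup X\<^esub> f \<in> Bij X" and fg: "f \<otimes>\<^bsub>BijGroup X\<^esub> g \<in> Bij X"
    using B.inv_closed[OF c(1)] B.m_closed[OF c] by (simp_all only: carrier_BijGroup)
  show ?thesis
    using x g fB gB iB fg orb_apply_closed[OF f x]
    by (simp add: conj_by_def BijGroup_apply BijGroup_inv_apply)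
qed

text \<open>Every point has the form \<open>f x\<close>, so the intertwining relation
  \<open>k f = f g\<close> determines \<open>k\<close>. This criterion spares later computations
  with the inverse of \<open>f\<close>.\<close>

lemma conj_by_eqI:
  assumes f: "f \<in> carrier E" and g: "g \<in> carrier G" and k: "k \<in> carrier G"
    and eq: "\<And>x. x \<in> X \<Longrightarrow> k (f x) = f (g x)"
  shows "conj_by f g = k"
proof (rule carrier_ext[OF conj_by_closed[OF f g] k])
  fix y assume "y \<in> X"
  then obtain x where "x \<in> X" "y = f x" by (rule orb_surj[OF f])
  then show "conj_by f g y = k y" using conj_by_apply[OF f g] eq by simp
qed

lemma conj_by_mult:
  assumes "f \<in> carrier E" "h \<in> carrier E" "g \<in> carrier G"
  shows "conj_by (f \<otimes>\<^bsub>E\<^esub> h) g = conj_by f (conj_by h g)"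
proof (rule conj_by_eqI)
  show "conj_by f (conj_by h g) ((f \<otimes>\<^bsub>E\<^esub> h) x) = (f \<otimes>\<^bsub>E\<^esub> h) (g x)" if "x \<in> X" for x
    using assms that orb.mult_apply[of f h] by (simp add: conj_by_apply conj_by_closed orb_apply_closed)
qed (use assms in \<open>simp_all add: conj_by_closed\<close>)

lemma conj_by_one: "g \<in> carrier G \<Longrightarrow> conj_by \<one>\<^bsub>E\<^esub> g = g"
  using orb.one_apply by (intro conj_by_eqI) simp_all

lemma conj_by_hom: "f \<in> carrier E \<Longrightarrow> conj_by f \<in> hom G G"
  by (rule homI) (simp_all add: conj_by_closed conj_by_apply orb_apply_closed conj_by_eqI)

lemma conj_by_inverse:
  assumes "f \<in> carrier E" "g \<in> carrier G"
  shows "conj_by (inv\<^bsub>E\<^esub> f) (conj_by f g) = g" "conj_by f (conj_by (inv\<^bsub>E\<^esub> f) g) = g"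
  using assms conj_by_mult[of "inv\<^bsub>E\<^esub> f" f g] conj_by_mult[of f "inv\<^bsub>E\<^esub> f" g]
  by (simp_all add: conj_by_one)

text \<open>If \<open>g\<close> fixes the finite set \<open>f^-1(A)\<close> pointwise, then its
  conjugate by \<open>f\<close> fixes \<open>A\<close> pointwise.\<close>

lemma conj_by_continuous:
  assumes f: "f \<in> carrier E" shows "continuous_map T T (conj_by f)"
proof (rule continuous_map_if_open_vimage[OF conj_by_hom[OF f]])
  fix A assume A: "finite A" "A \<subseteq> X"
  let ?H = "{g \<in> carrier G. conj_by f g \<in> pw_stab L M A}"
  have fi: "f ((inv\<^bsub>E\<^esub> f) a) = a" "(inv\<^bsub>E\<^esub> f) a \<in> X" if "a \<in> A" for a
    using A that f orb.inv_apply(2)[of f a] orb.apply_closed[of "inv\<^bsub>E\<^esub> f" a] by auto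
  have "conj_by f g a = a" if "g \<in> pw_stab L M ((inv\<^bsub>E\<^esub> f) ` A)" "a \<in> A" for g a
    using conj_by_apply[OF f, of g "(inv\<^bsub>E\<^esub> f) a"] that fi by (simp add: pw_stab_def)
  then have "pw_stab L M ((inv\<^bsub>E\<^esub> f) ` A) \<subseteq> ?H"
    using f by (auto simp: conj_by_closed pw_stab_def)
  moreover have "finite ((inv\<^bsub>E\<^esub> f) ` A)" "(inv\<^bsub>E\<^esub> f) ` A \<subseteq> X" using A fi by auto
  ultimately show "openin T ?H"
    using openin_subgroup_iff[OF subgroup_vimage[OF conj_by_hom[OF f] subgroup_pw_stab[OF A(2)]]]
    by blast
qed

lemma conj_by_Aut_top:
  assumes f: "f \<in> carrier E" shows "conj_by f \<in> carrier (Aut_top G T)"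
proof -
  have i: "inv\<^bsub>E\<^esub> f \<in> carrier E" using f by simp
  have "homeomorphic_maps T T (conj_by f) (conj_by (inv\<^bsub>E\<^esub> f))"
    unfolding homeomorphic_maps_def
    using conj_by_continuous[OF f] conj_by_continuous[OF i] conj_by_inverse[OF f] by simp
  then have "homeomorphic_map T T (conj_by f)" by (rule homeomorphic_maps_imp_map)
  moreover have "bij_betw (conj_by f) (carrier G) (carrier G)"
    by (rule bij_betw_byWitness[where f' = "conj_by (inv\<^bsub>E\<^esub> f)"])
      (use f i conj_by_inverse conj_by_closed in auto)
  moreover have "conj_by f \<in> extensional (carrier G)" by (simp add: conj_by_def)
  ultimately show ?thesis
    using conj_by_hom[OF f] by (simp add: Aut_top_def AutoGroup_def auto_def Bij_def)
qed

lemma conj_by_hom_Aut_top: "conj_by \<in> hom E (Aut_top G T)"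
proof (rule homI)
  fix f h assume fh: "f \<in> carrier E" "h \<in> carrier E"
  have B: "conj_by f \<in> Bij (carrier G)" "conj_by h \<in> Bij (carrier G)"
    using fh[THEN conj_by_Aut_top] by (simp_all add: Aut_top_def AutoGroup_def auto_def)
  have "conj_by (f \<otimes>\<^bsub>E\<^esub> h) = compose (carrier G) (conj_by f) (conj_by h)"
  proof
    fix g show "conj_by (f \<otimes>\<^bsub>E\<^esub> h) g = compose (carrier G) (conj_by f) (conj_by h) g"
      using conj_by_mult[OF fh] by (cases "g \<in> carrier G") (auto simp: compose_def conj_by_def)
  qed
  also have "\<dots> = conj_by f \<otimes>\<^bsub>Aut_top G T\<^esub> conj_by h"
    using B by (simp add: Aut_top_def AutoGroup_def BijGroup_def)
  finally show "conj_by (f \<otimes>\<^bsub>E\<^esub> h) = conj_by f \<otimes>\<^bsub>Aut_top G T\<^esub> conj_by h" .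
qed (rule conj_by_Aut_top)

text \<open>Automatic continuity applies both to an automorphism and to its inverse.\<close>

lemma small_index_imp_Aut_top_eq:
  assumes "small_index_property L M" "countable X"
  shows "Aut_top G T = AutoGroup G"
proof -
  have "homeomorphic_map T T \<phi>" if "\<phi> \<in> auto G" for \<phi>
  proof -
    have iso: "\<phi> \<in> iso G G" using that by (simp add: auto_def iso_def Bij_def)
    let ?\<psi> = "inv_into (carrier G) \<phi>"
    have \<psi>: "?\<psi> \<in> iso G G" by (rule iso_set_sym[OF iso])
    have bij: "bij_betw \<phi> (carrier G) (carrier G)" using iso by (simp add: iso_def)
    have "homeomorphic_maps T T \<phi> ?\<psi>" unfolding homeomorphic_maps_def
      using small_index_imp_continuous[OF assms] iso \<psi> bij
      by (simp add: iso_def bij_betw_inv_into_left bij_betw_inv_into_right)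
    then show ?thesis by (rule homeomorphic_maps_imp_map)
  qed
  then have "{\<phi> \<in> carrier (AutoGroup G). homeomorphic_map T T \<phi>} = carrier (AutoGroup G)"
    by (auto simp: AutoGroup_def)
  then show ?thesis by (simp add: Aut_top_def)
qed

end

section \<open>Consequences of the Lascar Property\<close>

locale lascar_structure = aut_structure +
  assumes lascar: "lascar_property L M"
    and aclg_singleton: "a \<in> universe M \<Longrightarrow> aclg L M {a} = {a}"
begin

text \<open>The contrapositive of clause (i), phrased with setwise stabilizers so that inclusions of
  closed sets follow from facts about subgroups.\<close>

lemma lascar_subset:
  assumes "K \<in> fg_closed_sets L M" "S \<in> fg_closed_sets L M"
    and "\<And>g h. g \<in> pw_stab L M K \<Longrightarrow> h \<in> pw_stab L M S \<Longrightarrow>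
      inv\<^bsub>G\<^esub> g \<otimes>\<^bsub>G\<^esub> (h \<otimes>\<^bsub>G\<^esub> g) \<in> set_stab L M S"
  shows "S \<subseteq> K"
proof (rule ccontr)
  assume "\<not> S \<subseteq> K"
  then obtain g h where gh: "g \<in> pw_stab L M K" "h \<in> pw_stab L M S"
    and ne: "(inv\<^bsub>G\<^esub> g \<otimes>\<^bsub>G\<^esub> h \<otimes>\<^bsub>G\<^esub> g) ` S \<noteq> S"
    using conjunct1[OF lascar[unfolded lascar_property_def], THEN bspec, OF assms(1), THEN bspec, OF assms(2)]
    by blast
  have "g \<in> carrier G" "h \<in> carrier G" using gh by (simp_all add: pw_stab_def)
  then show False using assms(3)[OF gh] ne by (simp add: set_stab_def m_assoc)
qed

lemma lascar_sandwich:
  assumes "subgroup H G" "openin T H"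
  obtains K where "K \<in> fg_closed_sets L M" "pw_stab L M K \<subseteq> H" "H \<subseteq> set_stab L M K"
  using conjunct2[OF lascar[unfolded lascar_property_def], THEN spec, of H] assms by blast

text \<open>Both \<open>g\<close> and \<open>h\<close> in clause (i) stabilize \<open>S\<close>,
  hence so does the conjugate. It follows that the closed set which clause (ii) attaches to an open
  subgroup is unique.\<close>

lemma pw_stab_subset_set_stab:
  assumes K: "K \<in> fg_closed_sets L M" and S: "S \<in> fg_closed_sets L M"
    and sub: "pw_stab L M K \<subseteq> set_stab L M S"
  shows "S \<subseteq> K"
proof (rule lascar_subset[OF K S])
  fix g h assume "g \<in> pw_stab L M K" and h: "h \<in> pw_stab L M S"
  then have g: "g \<in> set_stab L M S" using sub by blast
  have "h \<in> set_stab L M S" using h by (auto simp: pw_stab_def set_stab_def image_iff)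
  with g show "inv\<^bsub>G\<^esub> g \<otimes>\<^bsub>G\<^esub> (h \<otimes>\<^bsub>G\<^esub> g) \<in> set_stab L M S"
    by (intro subgroup.m_closed[OF subgroup_set_stab] subgroup.m_inv_closed[OF subgroup_set_stab]
          fg_closed_sets_subset[OF S])
qed

text \<open>The hypothesis on \<open>F\<close> says that finitely many right cosets of
  \<open>V \<inter> gVg^-1\<close> cover \<open>V\<close>. A closed set \<open>K\<close> attached to
  an open subgroup of this intersection that is normal in \<open>V\<close> satisfies
  \<open>g(S) \<subseteq> K \<subseteq> S\<close>.\<close>

lemma commensurated_imp_image_subset:
  assumes V: "subgroup V G" "openin T V" and S: "S \<in> fg_closed_sets L M"
    and SV: "pw_stab L M S \<subseteq> V" "V \<subseteq> set_stab L M S" and g: "g \<in> carrier G"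
    and F: "finite F" "F \<subseteq> carrier G"
      "\<And>x. x \<in> V \<Longrightarrow> \<exists>f\<in>F. x \<otimes>\<^bsub>G\<^esub> f \<in> V \<and> inv\<^bsub>G\<^esub> g \<otimes>\<^bsub>G\<^esub> (x \<otimes>\<^bsub>G\<^esub> f \<otimes>\<^bsub>G\<^esub> g) \<in> V"
  shows "g ` S \<subseteq> S"
proof -
  let ?c = "\<lambda>x n. inv\<^bsub>G\<^esub> x \<otimes>\<^bsub>G\<^esub> (n \<otimes>\<^bsub>G\<^esub> x)"
  define W where "W = V \<inter> {v \<in> carrier G. ?c g v \<in> V}"
  \<comment> \<open>the normal core of \<open>W = V \<inter> gVg\<inverse>\<close> in \<open>V\<close>; it is open because \<open>W\<close> has finite index in \<open>V\<close>\<close>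
  define N where "N = (\<Inter>x\<in>V. {n \<in> carrier G. ?c x n \<in> W})"
  have VG: "V \<subseteq> carrier G" by (rule subgroup.subset[OF V(1)])
  have Wsub: "subgroup W G" unfolding W_def
    by (rule subgroups_Inter_pair[OF V(1) subgroup_vimage[OF conj_hom[OF g] V(1)]])
  have oneV: "\<one>\<^bsub>G\<^esub> \<in> V" by (rule subgroup.one_closed[OF V(1)])
  have Nsub: "subgroup N G" unfolding N_def
    using VG oneV by (intro subgroups_Inter) (auto intro!: subgroup_vimage[OF conj_hom Wsub])
  have NW: "N \<subseteq> W" unfolding N_def using oneV by (auto dest!: bspec[OF _ oneV])
  obtain A where A: "finite A" "A \<subseteq> X" "pw_stab L M A \<subseteq> V"
    using V openin_subgroup_iff by blast
  have AW: "pw_stab L M (A \<union> g ` A) \<subseteq> W"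
  proof
    fix v assume v: "v \<in> pw_stab L M (A \<union> g ` A)"
    then have "v \<in> pw_stab L M A" "v \<in> pw_stab L M (g ` A)" by (auto simp: pw_stab_def)
    then show "v \<in> W"
      using A(3) pw_stab_image_conj[OF g A(2)] by (auto simp: W_def pw_stab_def)
  qed
  \<comment> \<open>Every conjugate \<open>xWx^-1\<close> with \<open>x\<close> in \<open>V\<close>
    equals \<open>fWf^-1\<close> for some \<open>f\<close> in \<open>F\<close>, and the latter
    contains the pointwise stabilizer of \<open>f(A \<union> g(A))\<close>. So fixing the finite set
    \<open>?B\<close> suffices for all of them.\<close>
  let ?B = "\<Union>f\<in>F. f ` (A \<union> g ` A)"
  have AX: "A \<union> g ` A \<subseteq> X" using A g by auto
  have "n \<in> N" if n: "n \<in> pw_stab L M ?B" for n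
  proof -
    have nc: "n \<in> carrier G" using n by (simp add: pw_stab_def)
    have "?c x n \<in> W" if x: "x \<in> V" for x
    proof -
      have xc: "x \<in> carrier G" using x VG by blast
      obtain f where f: "f \<in> F" "inv\<^bsub>G\<^esub> x \<otimes>\<^bsub>G\<^esub> f \<in> W"
        using F(3)[OF subgroup.m_inv_closed[OF V(1) x]] F(2) xc by (auto simp: W_def)
      have fc: "f \<in> carrier G" using f F(2) by blast
      have "n \<in> pw_stab L M (f ` (A \<union> g ` A))" using n f(1) by (auto simp: pw_stab_def)
      then have "?c f n \<in> W" using pw_stab_image_conj[OF fc AX] AW by blast
      \<comment> \<open>The element \<open>w = x^-1 f\<close> lies in \<open>W\<close>, and
        conjugating \<open>f^-1 n f\<close> by \<open>w\<close> gives
        \<open>x^-1 n x\<close>.\<close>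
      then have "(inv\<^bsub>G\<^esub> x \<otimes>\<^bsub>G\<^esub> f) \<otimes>\<^bsub>G\<^esub> ?c f n \<otimes>\<^bsub>G\<^esub> inv\<^bsub>G\<^esub> (inv\<^bsub>G\<^esub> x \<otimes>\<^bsub>G\<^esub> f) \<in> W"
        using f(2) Wsub by (simp add: subgroup.m_closed subgroup.m_inv_closed)
      also have "(inv\<^bsub>G\<^esub> x \<otimes>\<^bsub>G\<^esub> f) \<otimes>\<^bsub>G\<^esub> ?c f n \<otimes>\<^bsub>G\<^esub> inv\<^bsub>G\<^esub> (inv\<^bsub>G\<^esub> x \<otimes>\<^bsub>G\<^esub> f) = ?c x n"
        using xc fc nc by (intro carrier_ext) (simp_all add: inv_mult_group)
      finally show ?thesis .
    qed
    then show ?thesis using nc by (auto simp: N_def)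
  qed
  then have "openin T N"
    using openin_subgroup_iff[OF Nsub] F AX A(1) by (auto intro!: exI[of _ ?B] simp: subset_iff)
  then obtain K where K: "K \<in> fg_closed_sets L M" "pw_stab L M K \<subseteq> N" "N \<subseteq> set_stab L M K"
    using lascar_sandwich[OF Nsub] by blast
  \<comment> \<open>\<open>V\<close> normalizes \<open>N\<close> and contains \<open>G_(S)\<close>,
    so conjugates of \<open>G_(K)\<close> by \<open>G_(S)\<close> stay in \<open>N\<close> and
    therefore stabilize \<open>K\<close>.\<close>
  have "K \<subseteq> S"
  proof (rule lascar_subset[OF S K(1)])
    fix y h assume y: "y \<in> pw_stab L M S" and h: "h \<in> pw_stab L M K"
    have yV: "y \<in> V" and hN: "h \<in> N" using y h SV K by auto
    have c: "y \<in> carrier G" "h \<in> carrier G" using y h by (simp_all add: pw_stab_def)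
    have "?c x (?c y h) \<in> W" if x: "x \<in> V" for x
    proof -
      have "?c (y \<otimes>\<^bsub>G\<^esub> x) h \<in> W"
        using hN subgroup.m_closed[OF V(1) yV x] by (simp add: N_def)
      also have "?c (y \<otimes>\<^bsub>G\<^esub> x) h = ?c x (?c y h)"
        using c x VG by (intro carrier_ext) (auto simp: inv_mult_group)
      finally show ?thesis .
    qed
    then have "?c y h \<in> N" using c by (simp add: N_def)
    then show "?c y h \<in> set_stab L M K" using K by blast
  qed
  \<comment> \<open>\<open>G_(K)\<close> lies in \<open>gVg^-1\<close>, which stabilizes
    \<open>g(S)\<close> because \<open>V\<close> stabilizes \<open>S\<close>.\<close>
  moreover have "g ` S \<subseteq> K"
  proof (rule pw_stab_subset_set_stab[OF K(1) image_fg_closed_sets[OF g S]], rule subsetI)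
    fix h assume "h \<in> pw_stab L M K"
    then have hc: "h \<in> carrier G" and "?c g h \<in> V" using K(2) NW by (auto simp: W_def)
    then have st: "?c g h \<in> set_stab L M S" using SV by blast
    have SX: "S \<subseteq> X" by (rule fg_closed_sets_subset[OF S])
    have "h ` g ` S = g ` ?c g h ` S"
      using SX hc g unfolding image_image by (intro image_cong) auto
    also have "\<dots> = g ` S" using st by (simp add: set_stab_def)
    finally show "h \<in> set_stab L M (g ` S)" using hc by (simp add: set_stab_def)
  qed
  ultimately show ?thesis by blast
qed

lemma singleton_fg_closed: "a \<in> X \<Longrightarrow> {a} \<in> fg_closed_sets L M"
  unfolding fg_closed_sets_def using aclg_singleton[of a] by (auto intro!: exI[of _ "{a}"])

text \<open>A closed set attached to \<open>P\<close> is contained in \<open>{a}\<close>, and it is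
  nonempty because \<open>P\<close> is proper; so it is \<open>{a}\<close> and \<open>P\<close>
  fixes \<open>a\<close>.\<close>

lemma stabilizer_maximal_open:
  assumes a: "a \<in> X" and P: "subgroup P G" "openin T P" "pw_stab L M {a} \<subseteq> P" "P \<noteq> carrier G"
  shows "P = pw_stab L M {a}"
proof -
  obtain K where K: "K \<in> fg_closed_sets L M" "pw_stab L M K \<subseteq> P" "P \<subseteq> set_stab L M K"
    using lascar_sandwich P by blast
  have "K \<subseteq> {a}"
    using pw_stab_subset_set_stab[OF singleton_fg_closed[OF a] K(1)] P K by blast
  moreover have "K \<noteq> {}"
    using K(2) P(4) subgroup.subset[OF P(1)] by (auto simp: pw_stab_def)
  ultimately have "K = {a}" by blast
  then show ?thesis using K P(3) a by (auto simp: set_stab_singleton)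
qed

text \<open>Singletons are closed and their setwise and pointwise stabilizers coincide, so an
  inclusion of point stabilizers yields an inclusion of singletons.\<close>

lemma stabilizer_inj:
  assumes "a \<in> X" "b \<in> X" "pw_stab L M {a} \<subseteq> pw_stab L M {b}" shows "a = b"
proof -
  have "{b} \<subseteq> {a}"
    by (rule pw_stab_subset_set_stab) (use assms in \<open>auto simp: singleton_fg_closed set_stab_singleton\<close>)
  then show ?thesis by simp
qed

section \<open>Topological automorphisms permute the point stabilizers\<close>

lemma aclg_empty:
  assumes b: "b \<in> aclg L M {}" shows "X = {b}"
proof -
  \<comment> \<open>By monotonicity \<open>b\<close> lies in \<open>acl({x}) = {x}\<close>.\<close>
  have "x = b" if "x \<in> X" for x
    using b aclg_mono[of "{}" "{x}"] aclg_singleton[OF that] by auto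
  then show ?thesis using b aclg_subset[of "{}"] by blast
qed

text \<open>The conclusion is \<open>\<phi>(G_a) = G_b\<close>, spelled out on elements. Openness is
  expressed through images so that the lemma applies equally to the inverse of
  \<open>\<phi>\<close>.\<close>

lemma open_automorphism_stabilizer:
  assumes iso: "\<phi> \<in> iso G G"
    and op: "\<And>U. U \<subseteq> carrier G \<Longrightarrow> openin T (\<phi> ` U) \<longleftrightarrow> openin T U"
    and a: "a \<in> X"
  shows "\<exists>b\<in>X. \<forall>g\<in>carrier G. \<phi> g b = b \<longleftrightarrow> g a = a"
\<comment> \<open>If \<open>acl({})\<close> is nonempty, the domain is a single point. Otherwise
  \<open>{}\<close> is itself closed and no point is fixed by all of \<open>G\<close>, so every
  point stabilizer is proper.\<close>
proof (cases "aclg L M {} = {}")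
  case False
  then obtain b where "X = {b}" using aclg_empty by blast
  then have "g a = a" if "g \<in> carrier G" for g using apply_closed[OF that a] a by auto
  moreover have "\<phi> g \<in> carrier G" if "g \<in> carrier G" for g
    using iso that by (auto simp: iso_def hom_def)
  ultimately show ?thesis using a by blast
next
  case True
  have hom: "\<phi> \<in> hom G G" and inj: "inj_on \<phi> (carrier G)" and surj: "\<phi> ` carrier G = carrier G"
    using iso by (auto simp: iso_def bij_betw_def)
  interpret \<phi>: group_hom G G \<phi>
    using hom by unfold_locales
  have vop: "openin T {g \<in> carrier G. \<phi> g \<in> U}" if "openin T U" for U
  proof -
    have "U \<subseteq> carrier G" using that openin_T_iff by blast
    moreover have "\<phi> ` {g \<in> carrier G. \<phi> g \<in> U} = \<phi> ` carrier G \<inter> U" by auto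
    ultimately have "\<phi> ` {g \<in> carrier G. \<phi> g \<in> U} = U" unfolding surj by auto
    then show ?thesis using op[of "{g \<in> carrier G. \<phi> g \<in> U}"] that by auto
  qed
  have vall: "carrier G \<subseteq> U" if "{g \<in> carrier G. \<phi> g \<in> U} = carrier G" for U
  proof -
    have "\<phi> ` carrier G \<subseteq> U" using that by auto
    then show ?thesis by (simp only: surj)
  qed
  have not_all: "pw_stab L M {x} \<noteq> carrier G" if x: "x \<in> X" for x
  proof
    assume "pw_stab L M {x} = carrier G"
    then have "(\<lambda>g. g x) ` pw_stab L M {} \<subseteq> {x}" by (auto simp: pw_stab_def)
    then have "x \<in> aclg L M {}" using x finite_subset[of _ "{x}"] by (simp add: aclg_def)
    then show False using True by blast
  qed
  let ?Ga = "pw_stab L M {a}"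
  have Ga: "subgroup ?Ga G" using a by (intro subgroup_pw_stab) simp
  have GaG: "?Ga \<subseteq> carrier G" by (auto simp: pw_stab_def)
  have "openin T ?Ga" using openin_subgroup_iff[OF Ga] a by blast
  then have "openin T (\<phi> ` ?Ga)" using op[OF GaG] by blast
  moreover have "subgroup (\<phi> ` ?Ga) G" by (rule \<phi>.subgroup_img_is_subgroup[OF Ga])
  ultimately obtain K where K: "K \<in> fg_closed_sets L M"
    "pw_stab L M K \<subseteq> \<phi> ` ?Ga" "\<phi> ` ?Ga \<subseteq> set_stab L M K"
    using lascar_sandwich by blast
  have KX: "K \<subseteq> X" by (rule fg_closed_sets_subset[OF K(1)])
  obtain A0 where A0: "finite A0" "A0 \<subseteq> X" "K = aclg L M A0"
    using K(1) by (auto simp: fg_closed_sets_def)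
  have "K \<noteq> {}"
  proof
    assume "K = {}"
    then have "carrier G \<subseteq> \<phi> ` ?Ga" using K(2) by (auto simp: pw_stab_def)
    then have "\<phi> ` ?Ga = \<phi> ` carrier G" using GaG surj by blast
    then have "?Ga = carrier G" using inj_on_image_eq_iff[OF inj GaG order_refl] by blast
    then show False using not_all a by blast
  qed
  then obtain b where b: "b \<in> K" by blast
  have bX: "b \<in> X" using b KX by blast
  let ?P = "{g \<in> carrier G. \<phi> g \<in> set_stab L M K}"
  have "openin T (set_stab L M K)"
    using openin_subgroup_iff[OF subgroup_set_stab[OF KX]] A0 pw_stab_subset_set_stab_aclg by blast
  then have P1: "openin T ?P" by (rule vop)
  have P2: "subgroup ?P G" by (rule subgroup_vimage[OF hom subgroup_set_stab[OF KX]])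
  have P3: "?Ga \<subseteq> ?P" using K(3) GaG by blast
  \<comment> \<open>If all of \<open>G = G_({})\<close> stabilized \<open>K\<close>, then the
    nonempty set \<open>K\<close> would be contained in the closed set \<open>{}\<close>.\<close>
  have P4: "?P \<noteq> carrier G"
  proof
    assume "?P = carrier G"
    then have "carrier G \<subseteq> set_stab L M K" by (rule vall)
    then have "pw_stab L M {} \<subseteq> set_stab L M K" by (auto simp: pw_stab_def)
    moreover have "{} \<in> fg_closed_sets L M"
      using True unfolding fg_closed_sets_def by (auto intro!: exI[of _ "{}"])
    ultimately show False using pw_stab_subset_set_stab[OF _ K(1)] b by blast
  qed
  have P: "?P = ?Ga" by (rule stabilizer_maximal_open[OF a P2 P1 P3 P4])
  \<comment> \<open>Adjoining \<open>b\<close> puts \<open>G_(A)\<close> inside \<open>G_b\<close>,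
    while \<open>A\<close> stays finite, lies in \<open>K\<close> and still has \<open>K\<close> in
    its closure.\<close>
  define A where "A = insert b A0"
  have A: "finite A" "A \<subseteq> X" "A \<subseteq> K" "K \<subseteq> aclg L M A"
    using A0 b bX aclg_mono[of A0 A] subset_aclg[OF A0(2)] by (auto simp: A_def)
  let ?V = "{g \<in> carrier G. \<phi> g \<in> pw_stab L M A}"
  have V: "subgroup ?V G" by (rule subgroup_vimage[OF hom subgroup_pw_stab[OF A(2)]])
  have Vo: "openin T ?V"
    using openin_subgroup_iff[OF subgroup_pw_stab[OF A(2)]] A by (intro vop) blast
  have "pw_stab L M A \<subseteq> pw_stab L M A0" by (auto simp: pw_stab_def A_def)
  then have VGa: "?V \<subseteq> ?Ga"
    using P pw_stab_subset_set_stab_aclg[OF A0(2)] A0(3) by blast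
  obtain S where S: "S \<in> fg_closed_sets L M" "pw_stab L M S \<subseteq> ?V" "?V \<subseteq> set_stab L M S"
    using lascar_sandwich[OF V Vo] by blast
  \<comment> \<open>As \<open>\<phi> g\<close> stabilizes \<open>K\<close>, it commensurates
    \<open>G_(A)\<close>. Pulling the finite set of coset representatives back along
    \<open>\<phi>\<close> shows that \<open>g\<close> commensurates \<open>?V\<close>.\<close>
  have inv_S: "g ` S \<subseteq> S" if g: "g \<in> ?Ga" for g
  proof -
    have gc: "g \<in> carrier G" and k: "\<phi> g \<in> set_stab L M K" using g P by auto
    obtain F where F: "finite F" "F \<subseteq> carrier G" "\<forall>x\<in>pw_stab L M A. \<exists>f\<in>F.
      x \<otimes>\<^bsub>G\<^esub> f \<in> pw_stab L M A \<and>
      inv\<^bsub>G\<^esub> (\<phi> g) \<otimes>\<^bsub>G\<^esub> (x \<otimes>\<^bsub>G\<^esub> f \<otimes>\<^bsub>G\<^esub> \<phi> g) \<in> pw_stab L M A"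
      using pw_stab_commensurated[OF A(1,3,4) k] by blast
    obtain F' where F': "F' \<subseteq> carrier G" "finite F'" "F = \<phi> ` F'"
      using finite_subset_image[OF F(1), of \<phi> "carrier G", unfolded surj, OF F(2)] by blast
    show ?thesis
    proof (rule commensurated_imp_image_subset[OF V Vo S gc F'(2,1)])
      fix x assume "x \<in> ?V"
      then have x: "x \<in> carrier G" "\<phi> x \<in> pw_stab L M A" by auto
      then obtain f where f: "f \<in> F'" "\<phi> x \<otimes>\<^bsub>G\<^esub> \<phi> f \<in> pw_stab L M A"
        "inv\<^bsub>G\<^esub> (\<phi> g) \<otimes>\<^bsub>G\<^esub> (\<phi> x \<otimes>\<^bsub>G\<^esub> \<phi> f \<otimes>\<^bsub>G\<^esub> \<phi> g) \<in> pw_stab L M A"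
        using F(3) F'(3) by blast
      have "f \<in> carrier G" using f F' by blast
      then show "\<exists>f\<in>F'. x \<otimes>\<^bsub>G\<^esub> f \<in> ?V \<and> inv\<^bsub>G\<^esub> g \<otimes>\<^bsub>G\<^esub> (x \<otimes>\<^bsub>G\<^esub> f \<otimes>\<^bsub>G\<^esub> g) \<in> ?V"
        using f x gc by (intro bexI[of _ f]) auto
    qed
  qed
  have SX: "S \<subseteq> X" by (rule fg_closed_sets_subset[OF S(1)])
  \<comment> \<open>\<open>G_a\<close> maps \<open>S\<close> into itself, so conjugating an element
    of \<open>G_(S)\<close> by an element of \<open>G_a\<close> yields an element that again fixes
    \<open>S\<close> pointwise.\<close>
  have "S \<subseteq> {a}"
  proof (rule lascar_subset[OF singleton_fg_closed[OF a] S(1)])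
    fix g h assume g: "g \<in> ?Ga" and h: "h \<in> pw_stab L M S"
    have c: "g \<in> carrier G" "h \<in> carrier G" using g h by (auto simp: pw_stab_def)
    have "(inv\<^bsub>G\<^esub> g \<otimes>\<^bsub>G\<^esub> (h \<otimes>\<^bsub>G\<^esub> g)) s = s" if "s \<in> S" for s
    proof -
      have "g s \<in> S" using inv_S[OF g] that by blast
      then have "h (g s) = g s" using h by (simp add: pw_stab_def)
      then show ?thesis using c that SX by auto
    qed
    then show "inv\<^bsub>G\<^esub> g \<otimes>\<^bsub>G\<^esub> (h \<otimes>\<^bsub>G\<^esub> g) \<in> set_stab L M S"
      using c by (simp add: set_stab_def)
  qed
  moreover have "S \<noteq> {}"
  proof
    assume "S = {}"
    then have "carrier G \<subseteq> ?V" using S(2) by (auto simp: pw_stab_def)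
    then show False using VGa GaG not_all[OF a] by blast
  qed
  ultimately have "S = {a}" by blast
  \<comment> \<open>Now \<open>G_a = G_(S)\<close> lies in \<open>?V\<close>, and
    \<open>\<phi>\<close> maps \<open>?V\<close> into \<open>G_(A)\<close>, which fixes
    \<open>b\<close>.\<close>
  then have Ga_b: "?Ga \<subseteq> {g \<in> carrier G. \<phi> g \<in> pw_stab L M {b}}"
    using S(2) by (auto simp: pw_stab_def A_def)
  have Gb: "subgroup (pw_stab L M {b}) G" using bX by (intro subgroup_pw_stab) simp
  have "{g \<in> carrier G. \<phi> g \<in> pw_stab L M {b}} = ?Ga" (is "?Q = _")
  proof (rule stabilizer_maximal_open[OF a subgroup_vimage[OF hom Gb] vop Ga_b])
    show "openin T (pw_stab L M {b})" using openin_subgroup_iff[OF Gb] bX by blast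
    show "{g \<in> carrier G. \<phi> g \<in> pw_stab L M {b}} \<noteq> carrier G"
    proof
      assume "{g \<in> carrier G. \<phi> g \<in> pw_stab L M {b}} = carrier G"
      then have "carrier G \<subseteq> pw_stab L M {b}" by (rule vall)
      then show False using not_all[OF bX] by (auto simp: pw_stab_def)
    qed
  qed
  then have "\<phi> g b = b \<longleftrightarrow> g a = a" if "g \<in> carrier G" for g
  proof -
    have "g \<in> ?Q \<longleftrightarrow> g \<in> ?Ga" by (simp only: \<open>?Q = ?Ga\<close>)
    then show ?thesis using that by (simp add: pw_stab_def)
  qed
  then show ?thesis using bX by blast
qed

section \<open>Conjugation as an isomorphism onto the topological automorphisms\<close>

interpretation orb: aut_structure orbital_language "orbital_structure L M"
  by (rule aut_structure_orbital)

text \<open>An element of \<open>G\<close> fixing \<open>f x\<close> is the conjugate by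
  \<open>f\<close> of some \<open>g\<close> fixing \<open>x\<close>. If \<open>h\<close> induces the
  same conjugation, that element also fixes \<open>h x\<close>, and point stabilizers determine
  their points.\<close>

lemma conj_by_inj: "inj_on conj_by (carrier E)"
proof (rule inj_onI)
  fix f h assume f: "f \<in> carrier E" and h: "h \<in> carrier E" and eq: "conj_by f = conj_by h"
  have "f x = h x" if x: "x \<in> X" for x
  proof (rule stabilizer_inj)
    show "f x \<in> X" "h x \<in> X" using x f h by (simp_all add: orb_apply_closed)
    show "pw_stab L M {f x} \<subseteq> pw_stab L M {h x}"
    proof
      fix k assume "k \<in> pw_stab L M {f x}"
      then have k: "k \<in> carrier G" "k (f x) = f x" by (simp_all add: pw_stab_def)
      let ?g = "conj_by (inv\<^bsub>E\<^esub> f) k"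
      have g: "?g \<in> carrier G" "k = conj_by f ?g" using f k by (simp_all add: conj_by_closed conj_by_inverse)
      then have "f (?g x) = f x" using conj_by_apply[OF f g(1) x] k by metis
      then have gx: "?g x = x" using orb.apply_eq_iff[OF f, of "?g x" x] g(1) x by simp
      have "k = conj_by h ?g" using g(2) eq by metis
      then have "k (h x) = h (?g x)" using conj_by_apply[OF h g(1) x] by metis
      then show "k \<in> pw_stab L M {h x}" using gx k by (simp add: pw_stab_def)
    qed
  qed
  then show "f = h" using orb.carrier_ext[OF f h] by simp
qed

text \<open>The permutation \<open>f\<close> sends \<open>a\<close> to the unique \<open>b\<close>
  with \<open>\<phi>(G_a) = G_b\<close>. Applying \<open>\<phi>\<close> to the stabilizer of
  \<open>g a\<close>, a conjugate of \<open>G_a\<close>, gives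
  \<open>\<phi>(g) f = f g\<close>.\<close>

lemma conj_by_surj:
  assumes "\<phi> \<in> carrier (Aut_top G T)"
  shows "\<exists>f\<in>carrier E. conj_by f = \<phi>"
proof -
  have hom: "\<phi> \<in> hom G G" and ext: "\<phi> \<in> extensional (carrier G)"
    and bij: "bij_betw \<phi> (carrier G) (carrier G)" and homeo: "homeomorphic_map T T \<phi>"
    using assms by (auto simp: Aut_top_def AutoGroup_def auto_def Bij_def)
  interpret \<phi>: group_hom G G \<phi> using hom by unfold_locales
  have iso: "\<phi> \<in> iso G G" using hom bij by (simp add: iso_def)
  have op: "openin T (\<phi> ` U) \<longleftrightarrow> openin T U" if "U \<subseteq> carrier G" for U
    using homeomorphic_map_openness[OF homeo] that by simp
  let ?\<psi> = "inv_into (carrier G) \<phi>"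
  have isoi: "?\<psi> \<in> iso G G" by (rule iso_set_sym[OF iso])
  have \<psi>c: "?\<psi> k \<in> carrier G" if "k \<in> carrier G" for k
    using isoi that by (auto simp: iso_def bij_betw_def)
  have \<phi>\<psi>: "\<phi> (?\<psi> k) = k" if "k \<in> carrier G" for k using bij_betw_inv_into_right[OF bij that] .
  have \<psi>\<phi>: "?\<psi> (\<phi> k) = k" if "k \<in> carrier G" for k using bij_betw_inv_into_left[OF bij that] .
  have opi: "openin T (?\<psi> ` U) \<longleftrightarrow> openin T U" if U: "U \<subseteq> carrier G" for U
  proof -
    have "\<phi> ` ?\<psi> ` U = U" using U \<phi>\<psi> by (force simp: image_image)
    moreover have "?\<psi> ` U \<subseteq> carrier G" using U \<psi>c by auto
    ultimately show ?thesis using op[of "?\<psi> ` U"] by simp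
  qed
  have "\<forall>a\<in>X. \<exists>b. b \<in> X \<and> (\<forall>g\<in>carrier G. \<phi> g b = b \<longleftrightarrow> g a = a)"
    using open_automorphism_stabilizer[OF iso op] by blast
  then obtain f0 where f0: "\<And>a. a \<in> X \<Longrightarrow> f0 a \<in> X"
    "\<And>a g. a \<in> X \<Longrightarrow> g \<in> carrier G \<Longrightarrow> \<phi> g (f0 a) = f0 a \<longleftrightarrow> g a = a"
    unfolding bchoice_iff by blast
  define f where "f = restrict f0 X"
  have fX: "f a \<in> X" if "a \<in> X" for a using f0 that by (simp add: f_def)
  have stab: "\<phi> g (f a) = f a \<longleftrightarrow> g a = a" if "a \<in> X" "g \<in> carrier G" for a g
    using f0 that by (simp add: f_def)
  have uniq: "b = f a" if "a \<in> X" "b \<in> X" "\<And>g. g \<in> carrier G \<Longrightarrow> \<phi> g b = b \<longleftrightarrow> g a = a" for a b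
  proof (rule stabilizer_inj[OF \<open>b \<in> X\<close> fX[OF \<open>a \<in> X\<close>]])
    show "pw_stab L M {b} \<subseteq> pw_stab L M {f a}"
    proof
      fix k assume "k \<in> pw_stab L M {b}"
      then have k: "k \<in> carrier G" "k b = b" by (simp_all add: pw_stab_def)
      then have "?\<psi> k a = a" using that(3)[OF \<psi>c[OF k(1)]] \<phi>\<psi> by simp
      then have "k (f a) = f a" using stab[OF that(1) \<psi>c[OF k(1)]] \<phi>\<psi>[OF k(1)] by simp
      then show "k \<in> pw_stab L M {f a}" using k by (simp add: pw_stab_def)
    qed
  qed
  have inj: "inj_on f X"
  proof (rule inj_onI)
    fix x y assume xy: "x \<in> X" "y \<in> X" and eq: "f x = f y"
    have "g x = x \<longleftrightarrow> g y = y" if "g \<in> carrier G" for g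
      using stab[OF xy(1) that] stab[OF xy(2) that] eq by simp
    then have "pw_stab L M {x} \<subseteq> pw_stab L M {y}" by (auto simp: pw_stab_def)
    then show "x = y" by (rule stabilizer_inj[OF xy])
  qed
  \<comment> \<open>A preimage of \<open>b\<close> is the point that the inverse of
    \<open>\<phi>\<close> attaches to \<open>b\<close>.\<close>
  have surj: "\<exists>a\<in>X. b = f a" if b: "b \<in> X" for b
  proof -
    obtain a where a: "a \<in> X" "\<forall>k\<in>carrier G. ?\<psi> k a = a \<longleftrightarrow> k b = b"
      using open_automorphism_stabilizer[OF isoi opi b] by blast
    have "\<phi> g b = b \<longleftrightarrow> g a = a" if "g \<in> carrier G" for g
      using a(2)[rule_format, of "\<phi> g"] \<psi>\<phi>[OF that] that by simp
    then show ?thesis using uniq[OF a(1) b] a(1) by blast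
  qed
  have "f ` X = X" using fX surj by blast
  then have fB: "f \<in> Bij X" using inj by (simp add: Bij_def bij_betw_def f_def)
  have equiv: "\<phi> g (f a) = f (g a)" if g: "g \<in> carrier G" and a: "a \<in> X" for g a
  proof (rule uniq)
    fix h assume h: "h \<in> carrier G"
    let ?c = "inv\<^bsub>G\<^esub> g \<otimes>\<^bsub>G\<^esub> (h \<otimes>\<^bsub>G\<^esub> g)"
    have "\<phi> h (\<phi> g (f a)) = \<phi> g (f a) \<longleftrightarrow> \<phi> ?c (f a) = f a"
      using g h a fX by (simp add: inv_apply_iff)
    also have "\<dots> \<longleftrightarrow> ?c a = a" using g h by (intro stab[OF a]) simp
    also have "\<dots> \<longleftrightarrow> h (g a) = g a" using g h a by (simp add: inv_apply_iff)
    finally show "\<phi> h (\<phi> g (f a)) = \<phi> g (f a) \<longleftrightarrow> h (g a) = g a" .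
  qed (use g a fX in simp_all)
  \<comment> \<open>A witness \<open>g\<close> on the left gives \<open>\<phi> g\<close> on the
    right. Conversely, a witness \<open>k\<close> pulls back along \<open>\<phi>\<close>, and
    injectivity of \<open>f\<close> cancels \<open>f\<close>.\<close>
  have "(\<exists>g\<in>carrier G. ys = map g xs) \<longleftrightarrow> (\<exists>g\<in>carrier G. map f ys = map g (map f xs))"
    if xs: "xs \<in> tuples X n" and ys: "ys \<in> tuples X n" for n xs ys
  proof
    assume "\<exists>g\<in>carrier G. ys = map g xs"
    then obtain g where g: "g \<in> carrier G" "ys = map g xs" by blast
    have "map f ys = map (\<phi> g) (map f xs)" using g xs equiv[OF g(1)] by (auto simp: tuples_def)
    then show "\<exists>g\<in>carrier G. map f ys = map g (map f xs)" using g(1) \<phi>.hom_closed by blast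
  next
    assume "\<exists>g\<in>carrier G. map f ys = map g (map f xs)"
    then obtain k where k: "k \<in> carrier G" "map f ys = map k (map f xs)" by blast
    let ?g = "?\<psi> k"
    have g: "?g \<in> carrier G" "\<phi> ?g = k" using k \<psi>c \<phi>\<psi> by simp_all
    have "map k (map f xs) = map f (map ?g xs)"
      using xs equiv[OF g(1)] g(2) by (auto simp: tuples_def)
    then have "map f ys = map f (map ?g xs)" using k by simp
    moreover have "inj_on f (set ys \<union> set (map ?g xs))"
      by (rule inj_on_subset[OF inj]) (use xs ys g in \<open>auto simp: tuples_def\<close>)
    ultimately have "ys = map ?g xs" using inj_on_map_eq_map by blast
    then show "\<exists>g\<in>carrier G. ys = map g xs" using g(1) by blast
  qed
  then have fE: "f \<in> carrier E" using fB by (simp add: orbital_automorphism_iff)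
  have "conj_by f = \<phi>"
  proof (rule extensionalityI[of _ "carrier G"])
    show "conj_by f g = \<phi> g" if "g \<in> carrier G" for g
      using equiv[OF that] that by (intro conj_by_eqI[OF fE]) simp_all
  qed (use ext in \<open>simp_all add: conj_by_def\<close>)
  with fE show ?thesis by blast
qed

lemma Aut_top_iso_Aut_orbital: "Aut_top G T \<cong> E"
proof -
  have "conj_by ` carrier E = carrier (Aut_top G T)"
    using conj_by_surj conj_by_Aut_top by blast
  then have "conj_by \<in> iso E (Aut_top G T)"
    using conj_by_hom_Aut_top conj_by_inj by (simp add: iso_iff)
  then show ?thesis using orb.iso_sym is_isoI by blast
qed

end

theorem theorem3p6:
  fixes L :: "('f, 'r) language" and M :: "('f, 'r, 'a) fo_structure"
  assumes "countable_language L"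
    and "is_structure L M"
    and "countable (universe M)"
    and "lascar_property L M"
    and "\<forall>a\<in>universe M. aclg L M {a} = {a}"
  shows "Aut_top (Aut L M) (Aut_topology L M) \<cong> Aut orbital_language (orbital_structure L M)
     \<and> (small_index_property L M \<longrightarrow>
          AutoGroup (Aut L M) \<cong> Aut orbital_language (orbital_structure L M))"
proof -
  interpret lascar_structure L M
    using assms by unfold_locales auto
  show ?thesis
    using Aut_top_iso_Aut_orbital small_index_imp_Aut_top_eq assms(3) by auto
qed

end
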